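(* Let $p$ be a prime, $d\ge1$, $R=\mathbb{Z}/p^d\mathbb{Z}$, $\zeta=e^{2\pi i/p^d}$, let $G$ be a finite abelian $p$-group with $p^dG=0$, let $c>1$ and $\alpha_n=\frac{c\log n}{n}$. Let $\Omega$ be either $\Omega_1(n)=\{(k,l)\in[n]^2:k\ne l\}$ for all $n$ or $\Omega_2(n)=\{(k,l)\in[n]^2:k<l\}$ for all $n$, and let $\Delta=\{(k,k):k\in[n]\}$. Let $U:G^2\to R$ be any function and $B:G^2\times G^2\to R$ a map satisfying conditions (i), (ii), (iii) below. For each $n$ let $(x_{k,l,n})_{(k,l)\in\Omega\cup\Delta}$ be any family of $\alpha_n$-balanced random elements of $R$. Then $$\frac{1}{|G|^n}\Big|\sum_{(\mathbf{g}_1,\dots,\mathbf{g}_n)\in G^{2n}\setminus G_{tr}}\prod_{k\in[n]}\mathbb{E}\big(\zeta^{U(\mathbf{g}_k)x_{k,k,n}}\big)\prod_{(k,l)\in\Omega}\mathbb{E}\big(\zeta^{B(\mathbf{g}_k,\mathbf{g}_l)x_{k,l,n}}\big)\Big|\to 0\quad (n\to\infty),$$ where $G_{tr}=\{(\mathbf{g}_1,\dots,\mathbf{g}_n)\in (G^2)^n: U(\mathbf{g}_k)=B(\mathbf{g}_k,\mathbf{g}_l)=0 \text{ for all } k,l\in[n]\}$.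
   Context: A random element $x$ of $R$ is $\alpha$-balanced if its reduction $\bar x$ mod $p$ satisfies $\mathbb{P}(\bar x=r)\le1-\alpha$ for all $r\in\mathbb{F}_p$. For $B:G^2\times G^2\to R$ (not necessarily bilinear), a subset $W\subseteq G^2$ is isotropic if $B(\mathbf{g},\mathbf{g}')=0$ for all $\mathbf{g},\mathbf{g}'\in W$. Conditions: (i) the maximal possible cardinality of an isotropic subset of $G^2$ is $|G|$; (ii) if an isotropic subset $W$ has exactly $|G|$ elements, then $W=\mathbf{g}'+H$ for some subgroup $H\le G^2$ and $\mathbf{g}'\in G^2$, and for every $\mathbf{g}\notin W$ at least one of $x\mapsto B(\mathbf{g}'+x,\mathbf{g})$, $x\mapsto B(\mathbf{g},\mathbf{g}'+x)$ is a non-constant affine map $H\to R$; (iii) if $\Omega=\Omega_2$, then $B$ is symmetric or alternating. *)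

theory Defs
  imports "HOL-Probability.Probability" "Berlekamp_Zassenhaus.Finite_Field"
begin

text \<open>The ring \<open>R\<close> of integers modulo \<open>p^d\<close> is \<^typ>\<open>'r::nontriv mod_ring\<close> with
  \<open>CARD('r) = p^d\<close>; \<^const>\<open>to_int_mod_ring\<close> returns the representative in \<open>{0..<p^d}\<close>.
  The group \<open>G\<close> is a finite type \<open>'g\<close> of class \<^class>\<open>ab_group_add\<close>, and \<open>G\<^sup>2\<close> is
  \<^typ>\<open>'g \<times> 'g\<close> with componentwise operations.\<close>

definition zeta_pow :: "'r::nontriv mod_ring \<Rightarrow> complex" where
  "zeta_pow r = exp (2 * complex_of_real pi * \<i> / of_nat CARD('r)) ^ nat (to_int_mod_ring r)"

text \<open>The field with \<open>p\<close> elements is represented by \<open>{0..<p}\<close>. The reduction below is the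
  ring homomorphism from \<open>R\<close> only if \<open>p\<close> divides \<open>CARD('r)\<close>.\<close>

definition reduce_mod :: "nat \<Rightarrow> 'r::nontriv mod_ring \<Rightarrow> int" where
  "reduce_mod p x = to_int_mod_ring x mod int p"

definition balanced :: "nat \<Rightarrow> real \<Rightarrow> 'w measure \<Rightarrow> ('w \<Rightarrow> 'r::nontriv mod_ring) \<Rightarrow> bool" where
  "balanced p \<alpha> M x \<longleftrightarrow>
     (\<forall>r\<in>{0..<int p}. measure M {\<omega> \<in> space M. reduce_mod p (x \<omega>) = r} \<le> 1 - \<alpha>)"

definition Omega1 :: "nat \<Rightarrow> (nat \<times> nat) set" where
  "Omega1 n = {(k, l) \<in> {1..n} \<times> {1..n}. k \<noteq> l}"

definition Omega2 :: "nat \<Rightarrow> (nat \<times> nat) set" where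
  "Omega2 n = {(k, l) \<in> {1..n} \<times> {1..n}. k < l}"

definition Diag :: "nat \<Rightarrow> (nat \<times> nat) set" where
  "Diag n = {(k, k) |k. k \<in> {1..n}}"

definition isotropic :: "('v \<Rightarrow> 'v \<Rightarrow> 'r::nontriv mod_ring) \<Rightarrow> 'v set \<Rightarrow> bool" where
  "isotropic B W \<longleftrightarrow> (\<forall>g\<in>W. \<forall>g'\<in>W. B g g' = 0)"

definition is_subgroup :: "'v::ab_group_add set \<Rightarrow> bool" where
  "is_subgroup H \<longleftrightarrow> 0 \<in> H \<and> (\<forall>x\<in>H. \<forall>y\<in>H. x + y \<in> H) \<and> (\<forall>x\<in>H. - x \<in> H)"

definition affine_map_on :: "'v::ab_group_add set \<Rightarrow> ('v \<Rightarrow> 'r::nontriv mod_ring) \<Rightarrow> bool" where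
  "affine_map_on H f \<longleftrightarrow>
     (\<exists>\<phi> c. (\<forall>x\<in>H. \<forall>y\<in>H. \<phi> (x + y) = \<phi> x + \<phi> y) \<and> (\<forall>x\<in>H. f x = \<phi> x + c))"

definition nonconst_affine_map_on ::
  "'v::ab_group_add set \<Rightarrow> ('v \<Rightarrow> 'r::nontriv mod_ring) \<Rightarrow> bool" where
  "nonconst_affine_map_on H f \<longleftrightarrow> affine_map_on H f \<and> \<not> f constant_on H"

definition symmetric_map :: "('v \<Rightarrow> 'v \<Rightarrow> 'r::nontriv mod_ring) \<Rightarrow> bool" where
  "symmetric_map B \<longleftrightarrow> (\<forall>g g'. B g g' = B g' g)"

text \<open>For bilinear maps the first conjunct implies the second, but here \<open>B\<close> is an arbitrary map,
  so antisymmetry has to be stated.\<close>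

definition alternating_map :: "('v \<Rightarrow> 'v \<Rightarrow> 'r::nontriv mod_ring) \<Rightarrow> bool" where
  "alternating_map B \<longleftrightarrow> (\<forall>g. B g g = 0) \<and> (\<forall>g g'. B g g' = - B g' g)"

definition condition_i ::
  "('g::{finite,ab_group_add} \<times> 'g \<Rightarrow> 'g \<times> 'g \<Rightarrow> 'r::nontriv mod_ring) \<Rightarrow> bool" where
  "condition_i B \<longleftrightarrow> Max {card W |W. isotropic B W} = CARD('g)"

definition condition_ii ::
  "('g::{finite,ab_group_add} \<times> 'g \<Rightarrow> 'g \<times> 'g \<Rightarrow> 'r::nontriv mod_ring) \<Rightarrow> bool" where
  "condition_ii B \<longleftrightarrow>
     (\<forall>W. isotropic B W \<and> card W = CARD('g) \<longrightarrow>
       (\<exists>H g'. is_subgroup H \<and> W = (+) g' ` H \<and>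
         (\<forall>g. g \<notin> W \<longrightarrow>
            nonconst_affine_map_on H (\<lambda>x. B (g' + x) g) \<or>
            nonconst_affine_map_on H (\<lambda>x. B g (g' + x)))))"

definition condition_iii ::
  "(nat \<Rightarrow> (nat \<times> nat) set) \<Rightarrow> ('v \<Rightarrow> 'v \<Rightarrow> 'r::nontriv mod_ring) \<Rightarrow> bool" where
  "condition_iii \<Omega> B \<longleftrightarrow> (\<Omega> = Omega2 \<longrightarrow> symmetric_map B \<or> alternating_map B)"

definition G_tr ::
  "('v \<Rightarrow> 'r::nontriv mod_ring) \<Rightarrow> ('v \<Rightarrow> 'v \<Rightarrow> 'r mod_ring) \<Rightarrow> nat \<Rightarrow> (nat \<Rightarrow> 'v) set" where
  "G_tr U B n = {g \<in> {1..n} \<rightarrow>\<^sub>E UNIV.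
     \<forall>k\<in>{1..n}. \<forall>l\<in>{1..n}. U (g k) = 0 \<and> B (g k) (g l) = 0}"

end

theory Submission
  imports Defs "HOL-Real_Asymp.Real_Asymp"
begin

text \<open>
  Write \<open>N = |G|\<close> and call a tuple close to \<open>T\<close> if all but few of its entries lie in \<open>T\<close>. Consider the
  set of values that a tuple takes with positive frequency. If this set is not isotropic, then quadratically many
  factors are bounded by \<open>1 - const \<cdot> log n / n\<close>, and the term is \<open>exp (- const \<cdot> n log n)\<close>. If it is isotropic
  with fewer than \<open>N\<close> elements, then the tuple is close to a set of fewer than \<open>N\<close> elements, and such tuples are
  exponentially rare relative to \<open>N\<^sup>n\<close>. Otherwise the tuple is close to an isotropic \<open>W = g' + H\<close> with \<open>N\<close> elements.

  In the last case let \<open>D\<close> be the set of the \<open>m\<close> indices whose entries lie outside \<open>W\<close>, and sum freely over the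
  entries in \<open>W\<close>. For every \<open>k\<close> outside \<open>D\<close> the sum over \<open>g\<^sub>k\<close> contains \<open>m\<close> factors
  \<open>E \<zeta>\<^bsup>v(h) x\<^esup>\<close> with \<open>v\<close> affine and not constant on \<open>H\<close>. Expanding all factors into random phases
  \<open>\<zeta>\<^bsup>F(h)\<^esup>\<close>, the average over \<open>H\<close> vanishes if \<open>F\<close> is affine but not constant, and is
  bounded away from 1 if \<open>F\<close> is not affine. Hence the average is essentially a point probability of a sum of \<open>m\<close>
  independent elements with no atom above \<open>1 - \<alpha>\<close>, so at most \<open>max \<rho> (1 - m \<alpha> (1 - 2 \<eta>))\<close>. The sum over
  \<open>D\<close> of the products over \<open>k\<close> then tends to 0 because \<open>c > 1\<close>.
\<close>

subsection \<open>Characters and balanced weights\<close>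

lemma zeta_pow_eq_cis:
  "zeta_pow (r::'r::nontriv mod_ring) = cis (2 * pi * of_int (to_int_mod_ring r) / of_nat CARD('r))"
proof -
  have nn: "0 \<le> to_int_mod_ring r"
    using range_to_int_mod_ring[where 'a='r] by auto
  have "exp (2 * complex_of_real pi * \<i> / of_nat CARD('r)) = cis (2 * pi / of_nat CARD('r))"
    by (simp add: cis_conv_exp algebra_simps)
  moreover have "real (nat (to_int_mod_ring r)) * (2 * pi / of_nat CARD('r)) =
      2 * pi * of_int (to_int_mod_ring r) / of_nat CARD('r)"
    using nn by simp
  ultimately show ?thesis
    by (simp add: zeta_pow_def Complex.DeMoivre del: times_divide_eq_right times_divide_eq_left)
qed

lemma norm_zeta_pow [simp]: "cmod (zeta_pow r) = 1"
  by (simp add: zeta_pow_eq_cis)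

lemma zeta_pow_0 [simp]: "zeta_pow 0 = 1"
  by (simp add: zeta_pow_def)

lemma cis_int_mod:
  assumes "q > 0"
  shows "cis (2 * pi * of_int (a mod int q) / of_nat q) = cis (2 * pi * of_int a / of_nat q)"
proof -
  have "2 * pi * of_int a / of_nat q = 2 * pi * of_int (a mod int q) / of_nat q + 2 * pi * of_int (a div int q)"
  proof -
    have "real_of_int a = of_int (a div int q) * of_nat q + of_int (a mod int q)"
      by (metis div_mult_mod_eq of_int_add of_int_mult of_int_of_nat_eq)
    then show ?thesis using assms by (simp add: field_simps)
  qed
  then show ?thesis
    by (simp add: cis_mult [symmetric])
qed

lemma zeta_pow_add: "zeta_pow (a + b) = zeta_pow a * zeta_pow (b::'r::nontriv mod_ring)"
proof -
  have "to_int_mod_ring (a + b) = (to_int_mod_ring a + to_int_mod_ring b) mod int CARD('r)"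
    by transfer simp
  then have "zeta_pow (a + b) =
      cis (2 * pi * of_int (to_int_mod_ring a + to_int_mod_ring b) / of_nat CARD('r))"
    by (simp only: zeta_pow_eq_cis) (rule cis_int_mod, simp)
  then show ?thesis
    by (simp add: zeta_pow_eq_cis cis_mult add_divide_distrib [symmetric] distrib_left)
qed

lemma zeta_pow_eq_1_iff [simp]: "zeta_pow r = 1 \<longleftrightarrow> r = (0::'r::nontriv mod_ring)"
proof
  assume "zeta_pow r = 1"
  have q: "real CARD('r) > 0" by simp
  have "to_int_mod_ring r \<in> {0..<int CARD('r)}"
    using range_to_int_mod_ring[where 'a='r] by blast
  then have b: "0 \<le> to_int_mod_ring r" "to_int_mod_ring r < int CARD('r)" by auto
  from \<open>zeta_pow r = 1\<close> have "cos (2 * pi * of_int (to_int_mod_ring r) / of_nat CARD('r)) = 1"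
    by (simp add: zeta_pow_eq_cis cis.ctr complex_eq_iff)
  then obtain m :: int where "2 * pi * of_int (to_int_mod_ring r) / of_nat CARD('r) = of_int m * 2 * pi"
    using cos_one_2pi_int by blast
  then have "real_of_int (to_int_mod_ring r) = of_int m * of_nat CARD('r)"
    using q by (simp add: field_simps)
  then have *: "to_int_mod_ring r = m * int CARD('r)"
    by (metis of_int_eq_iff of_int_mult of_int_of_nat_eq)
  have "int CARD('r) dvd to_int_mod_ring r"
    unfolding * by simp
  then have "to_int_mod_ring r = 0"
    using b zdvd_not_zless[of "to_int_mod_ring r" "int CARD('r)"] by force
  then show "r = 0" by simp
qed simp

lemma zeta_pow_minus: "zeta_pow (- a) = cnj (zeta_pow (a::'r::nontriv mod_ring))"
proof -
  have "zeta_pow (- a) * zeta_pow a = 1"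
    by (simp flip: zeta_pow_add)
  moreover have "zeta_pow a * cnj (zeta_pow a) = 1"
    using complex_norm_square[of "zeta_pow a"] by simp
  ultimately show ?thesis
    by (metis mult.assoc mult.left_neutral mult.right_neutral)
qed

lemma zeta_pow_eq_iff: "zeta_pow a = zeta_pow b \<longleftrightarrow> a = (b::'r::nontriv mod_ring)"
proof
  assume "zeta_pow a = zeta_pow b"
  then have "zeta_pow (a - b) = 1"
    using zeta_pow_add[of a "- b"] zeta_pow_add[of b "- b"] by simp
  then show "a = b" by simp
qed simp

text \<open>If the residues modulo \<open>p\<close> differ, the difference of the representatives is
  prime to \<open>p\<close>, hence a unit modulo \<open>p ^ d\<close>, and cannot annihilate
  \<open>a \<noteq> 0\<close>. This is how balancedness, a condition modulo \<open>p\<close>,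
  controls products \<open>t * r\<close> in the whole ring.\<close>

lemma reduce_mod_eq_if_mult_diff_eq_0:
  fixes a r r' :: "'r::nontriv mod_ring"
  assumes "prime p" "CARD('r) = p ^ d" "a \<noteq> 0" "a * (r - r') = 0"
  shows "reduce_mod p r = reduce_mod p r'"
proof (rule ccontr)
  assume ne: "reduce_mod p r \<noteq> reduce_mod p r'"
  let ?x = "to_int_mod_ring r - to_int_mod_ring r'"
  have "\<not> int p dvd ?x"
    using ne by (simp add: reduce_mod_def mod_eq_dvd_iff)
  then have "coprime (int p) ?x"
    using assms(1) by (simp add: prime_imp_coprime)
  then have cop: "coprime (int CARD('r)) ?x"
    by (simp add: assms(2))
  have "to_int_mod_ring (a * (r - r')) = (to_int_mod_ring a * ?x) mod int CARD('r)"
    by transfer (simp add: mod_simps)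
  then have "int CARD('r) dvd to_int_mod_ring a * ?x"
    using assms(4) by (simp add: mod_0_imp_dvd)
  then have "int CARD('r) dvd to_int_mod_ring a"
    using cop coprime_dvd_mult_left_iff by blast
  moreover have "to_int_mod_ring a \<in> {0..<int CARD('r)}"
    using range_to_int_mod_ring[where 'a='r] by blast
  ultimately have "to_int_mod_ring a = 0"
    using zdvd_not_zless[of "to_int_mod_ring a" "int CARD('r)"] by force
  with assms(3) show False by simp
qed

section \<open>Characteristic functions of balanced weights\<close>

definition balanced_weights :: "nat \<Rightarrow> real \<Rightarrow> ('r::nontriv mod_ring \<Rightarrow> real) \<Rightarrow> bool" where
  "balanced_weights p \<alpha> w \<longleftrightarrow> (\<forall>r. 0 \<le> w r) \<and> (\<Sum>r\<in>UNIV. w r) = 1 \<and>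
     (\<forall>i\<in>{0..<int p}. (\<Sum>r | reduce_mod p r = i. w r) \<le> 1 - \<alpha>)"

definition char_fun :: "('r::nontriv mod_ring \<Rightarrow> real) \<Rightarrow> 'r mod_ring \<Rightarrow> complex" where
  "char_fun w t = (\<Sum>r\<in>UNIV. of_real (w r) * zeta_pow (t * r))"

text \<open>\<open>S\<close> may be any part of one residue class, since the weights are
  nonnegative. The empty set is allowed and gives \<alpha> \<le> 1.\<close>

lemma balanced_weights_class_le:
  assumes "prime p" "balanced_weights p \<alpha> w" "\<And>r r'. r \<in> S \<Longrightarrow> r' \<in> S \<Longrightarrow> reduce_mod p r = reduce_mod p r'"
  shows "sum w S \<le> 1 - \<alpha>"
proof -
  have p: "p > 0" using assms(1) prime_gt_0_nat by blast
  obtain i where i: "i \<in> {0..<int p}" "S \<subseteq> {r. reduce_mod p r = i}"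
  proof (cases "S = {}")
    case True
    then show ?thesis using that[of 0] p by auto
  next
    case False
    then obtain r where "r \<in> S" by blast
    then have "S \<subseteq> {r'. reduce_mod p r' = reduce_mod p r}" using assms(3) by blast
    moreover have "reduce_mod p r \<in> {0..<int p}" using p by (simp add: reduce_mod_def)
    ultimately show ?thesis using that by blast
  qed
  have "sum w S \<le> (\<Sum>r | reduce_mod p r = i. w r)"
    using i assms(2) by (intro sum_mono2) (auto simp: balanced_weights_def)
  also have "\<dots> \<le> 1 - \<alpha>"
    using i assms(2) by (auto simp: balanced_weights_def)
  finally show ?thesis .
qed

lemma char_fun_0 [simp]:
  assumes "balanced_weights p \<alpha> w"
  shows "char_fun w 0 = 1"
  using assms by (simp add: char_fun_def balanced_weights_def flip: of_real_sum)

lemma norm_char_fun_le_1: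
  assumes "balanced_weights p \<alpha> w"
  shows "cmod (char_fun w t) \<le> 1"
proof -
  have "cmod (char_fun w t) \<le> (\<Sum>r\<in>UNIV. cmod (of_real (w r) * zeta_pow (t * r)))"
    unfolding char_fun_def by (rule norm_sum)
  also have "\<dots> = (\<Sum>r\<in>UNIV. w r)"
    using assms by (intro sum.cong) (auto simp: norm_mult balanced_weights_def)
  finally show ?thesis using assms by (simp add: balanced_weights_def)
qed

text \<open>Only finitely many points of the unit circle other than 1 occur, so their real parts
  stay a fixed distance below 1.\<close>

lemma zeta_pow_gap:
  "\<exists>\<kappa>>0. \<kappa> \<le> 1 \<and> (\<forall>t::'r::nontriv mod_ring. t \<noteq> 0 \<longrightarrow> Re (zeta_pow t) \<le> 1 - \<kappa>)"
proof -
  \<comment> \<open>The inserted 0 makes the maximum nonnegative, which gives \<kappa> \<le>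
    1.\<close>
  let ?S = "insert 0 (Re ` zeta_pow ` {t::'r mod_ring. t \<noteq> 0})"
  have fin: "finite ?S" by simp
  have "Re (zeta_pow t) < 1" if "t \<noteq> 0" for t :: "'r mod_ring"
  proof (rule ccontr)
    assume "\<not> Re (zeta_pow t) < 1"
    then have re: "Re (zeta_pow t) = 1"
      using complex_Re_le_cmod[of "zeta_pow t"] by simp
    then have "Im (zeta_pow t) = 0"
      using cmod_power2[of "zeta_pow t"] by simp
    with re have "zeta_pow t = 1" by (simp add: complex_eq_iff)
    with that show False by simp
  qed
  then have "Max ?S < 1" by (subst Max_less_iff[OF fin]) auto
  moreover have "Max ?S \<ge> 0" by (rule Max_ge[OF fin]) simp
  moreover have "Re (zeta_pow t) \<le> Max ?S" if "t \<noteq> 0" for t :: "'r mod_ring"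
    using that by (intro Max_ge[OF fin]) auto
  ultimately show ?thesis by (intro exI[of _ "1 - Max ?S"]) auto
qed

text \<open>Symmetrisation: the squared modulus is the mean of \<open>zeta_pow (t * (a - b))\<close>
  over two independent copies \<open>a\<close>, \<open>b\<close>. With probability at least \<alpha>
  they differ modulo \<open>p\<close>; then \<open>t * (a - b) \<noteq> 0\<close> and the real part
  loses \<kappa>. The factor 1/2 comes from taking the square root of
  \<open>1 - \<kappa> * \<alpha>\<close>.\<close>

lemma norm_char_fun_le:
  fixes w :: "'r::nontriv mod_ring \<Rightarrow> real"
  assumes p: "prime p" "CARD('r) = p ^ d" and w: "balanced_weights p \<alpha> w" and t: "t \<noteq> 0"
    and \<kappa>: "0 < \<kappa>" "\<And>t::'r mod_ring. t \<noteq> 0 \<Longrightarrow> Re (zeta_pow t) \<le> 1 - \<kappa>"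
  shows "cmod (char_fun w t) \<le> 1 - \<kappa> * \<alpha> / 2"
proof -
  have w0: "0 \<le> w r" for r using w by (simp add: balanced_weights_def)
  have w1: "(\<Sum>r\<in>UNIV. w r) = 1" using w by (simp add: balanced_weights_def)
  have "of_real ((cmod (char_fun w t))\<^sup>2) = char_fun w t * cnj (char_fun w t)"
    by (rule complex_norm_square)
  also have "\<dots> = (\<Sum>a\<in>UNIV. \<Sum>b\<in>UNIV. of_real (w a * w b) * zeta_pow (t * (a - b)))"
    unfolding char_fun_def cnj_sum sum_product
    by (intro sum.cong refl) (simp add: algebra_simps zeta_pow_minus[symmetric] zeta_pow_add[symmetric])
  finally have "(cmod (char_fun w t))\<^sup>2 = Re (\<Sum>a\<in>UNIV. \<Sum>b\<in>UNIV. of_real (w a * w b) * zeta_pow (t * (a - b)))"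
    by (metis Re_complex_of_real)
  also have "\<dots> = (\<Sum>a\<in>UNIV. \<Sum>b\<in>UNIV. w a * w b * Re (zeta_pow (t * (a - b))))"
    by (simp only: Re_sum) simp
  also have "\<dots> \<le> (\<Sum>a\<in>UNIV. \<Sum>b\<in>UNIV. w a * w b - \<kappa> * (w a * (if reduce_mod p b = reduce_mod p a then 0 else w b)))"
  proof (intro sum_mono)
    fix a b
    show "w a * w b * Re (zeta_pow (t * (a - b))) \<le> w a * w b - \<kappa> * (w a * (if reduce_mod p b = reduce_mod p a then 0 else w b))"
    proof (cases "reduce_mod p b = reduce_mod p a")
      case True
      have "Re (zeta_pow (t * (a - b))) \<le> 1"
        by (metis complex_Re_le_cmod norm_zeta_pow)
      from mult_left_mono[OF this, of "w a * w b"] show ?thesis using w0 True by simp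
    next
      case False
      then have "t * (a - b) \<noteq> 0"
        using reduce_mod_eq_if_mult_diff_eq_0[OF p t] by metis
      from mult_left_mono[OF \<kappa>(2)[OF this], of "w a * w b"] show ?thesis
        using w0 False by (simp add: algebra_simps)
    qed
  qed
  also have "\<dots> = 1 - \<kappa> * (\<Sum>a\<in>UNIV. w a * (\<Sum>b\<in>UNIV. if reduce_mod p b = reduce_mod p a then 0 else w b))"
    by (simp add: sum_subtractf sum_distrib_left[symmetric] w1)
  also have "\<dots> \<le> 1 - \<kappa> * (\<Sum>a\<in>UNIV. w a * \<alpha>)"
  proof -
    have "\<alpha> \<le> (\<Sum>b\<in>UNIV. if reduce_mod p b = reduce_mod p a then 0 else w b)" for a
    proof -
      have "1 = (\<Sum>b | reduce_mod p b = reduce_mod p a. w b) + (\<Sum>b | reduce_mod p b \<noteq> reduce_mod p a. w b)"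
        unfolding w1[symmetric] by (subst sum.union_disjoint[symmetric]) (auto intro!: sum.cong)
      moreover have "(\<Sum>b | reduce_mod p b = reduce_mod p a. w b) \<le> 1 - \<alpha>"
        by (rule balanced_weights_class_le[OF p(1) w]) auto
      moreover have "(\<Sum>b\<in>UNIV. if reduce_mod p b = reduce_mod p a then 0 else w b) = (\<Sum>b | reduce_mod p b \<noteq> reduce_mod p a. w b)"
        by (rule sum.mono_neutral_cong_right) auto
      ultimately show ?thesis by linarith
    qed
    then show ?thesis
      using \<kappa>(1) w0 by (auto intro!: sum_mono mult_left_mono)
  qed
  also have "\<dots> = 1 - \<kappa> * \<alpha>"
    using w1 by (simp add: sum_distrib_right[symmetric])
  also have "\<dots> \<le> (1 - \<kappa> * \<alpha> / 2)\<^sup>2"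
    using zero_le_square[of "\<kappa> * \<alpha> / 2"] by (simp add: power2_eq_square algebra_simps)
  finally have sq: "(cmod (char_fun w t))\<^sup>2 \<le> (1 - \<kappa> * \<alpha> / 2)\<^sup>2" .
  moreover have "0 \<le> 1 - \<kappa> * \<alpha> / 2"
  proof -
    have "\<alpha> \<le> 1" using balanced_weights_class_le[OF p(1) w, of "{}"] by simp
    moreover have "\<kappa> \<le> 2"
    proof -
      have "-1 \<le> Re (zeta_pow t)"
        using abs_Re_le_cmod[of "zeta_pow t"] by simp
      with \<kappa>(2)[OF t] show ?thesis by linarith
    qed
    ultimately show ?thesis using mult_left_mono[of \<alpha> 1 \<kappa>] \<kappa>(1) by linarith
  qed
  ultimately show ?thesis by (rule power2_le_imp_le)
qed

section \<open>From random elements to their laws\<close>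

lemma (in prob_space) expectation_finite_sum:
  fixes f :: "'b::finite \<Rightarrow> complex"
  assumes "X \<in> measurable M (count_space UNIV)"
  shows "(\<integral>\<omega>. f (X \<omega>) \<partial>M) = (\<Sum>r\<in>UNIV. of_real (prob {\<omega>\<in>space M. X \<omega> = r}) * f r)"
proof -
  have meas: "{\<omega>\<in>space M. X \<omega> = r} \<in> events" for r
    using assms by measurable
  have "(\<integral>\<omega>. f (X \<omega>) \<partial>M) = (\<integral>\<omega>. (\<Sum>r\<in>UNIV. indicat_real {\<omega>\<in>space M. X \<omega> = r} \<omega> *\<^sub>R f r) \<partial>M)"
    by (intro Bochner_Integration.integral_cong refl)
       (simp add: indicator_def of_bool_def if_distrib[of "\<lambda>c. c *\<^sub>R _"] cong: if_cong)
  also have "\<dots> = (\<Sum>r\<in>UNIV. (\<integral>\<omega>. indicat_real {\<omega>\<in>space M. X \<omega> = r} \<omega> *\<^sub>R f r \<partial>M))"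
    using meas by (intro Bochner_Integration.integral_sum integrable_scaleR_left) (auto simp: less_top[symmetric])
  also have "\<dots> = (\<Sum>r\<in>UNIV. of_real (prob {\<omega>\<in>space M. X \<omega> = r}) * f r)"
  proof (intro sum.cong refl)
    fix r
    have "(\<integral>\<omega>. indicat_real {\<omega>\<in>space M. X \<omega> = r} \<omega> *\<^sub>R f r \<partial>M) = (\<integral>\<omega>. indicat_real {\<omega>\<in>space M. X \<omega> = r} \<omega> \<partial>M) *\<^sub>R f r"
      using meas by (intro integral_scaleR_left) (auto simp: less_top[symmetric])
    also have "(\<integral>\<omega>. indicat_real {\<omega>\<in>space M. X \<omega> = r} \<omega> \<partial>M) = prob {\<omega>\<in>space M. X \<omega> = r}"
      using meas[of r] by (simp add: Int_absorb2 Collect_subset)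
    finally show "(\<integral>\<omega>. indicat_real {\<omega>\<in>space M. X \<omega> = r} \<omega> *\<^sub>R f r \<partial>M) = of_real (prob {\<omega>\<in>space M. X \<omega> = r}) * f r"
      by (simp add: scaleR_conv_of_real)
  qed
  finally show ?thesis .
qed

lemma (in prob_space) prob_finite_preimage:
  fixes X :: "'a \<Rightarrow> 'b::finite"
  assumes "X \<in> measurable M (count_space UNIV)"
  shows "(\<Sum>r\<in>S. prob {\<omega>\<in>space M. X \<omega> = r}) = prob {\<omega>\<in>space M. X \<omega> \<in> S}"
proof -
  have "{\<omega>\<in>space M. X \<omega> = r} \<in> events" for r
    using assms by measurable
  then have "prob (\<Union>r\<in>S. {\<omega>\<in>space M. X \<omega> = r}) = (\<Sum>r\<in>S. prob {\<omega>\<in>space M. X \<omega> = r})"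
    by (intro finite_measure_finite_Union) (auto simp: disjoint_family_on_def)
  moreover have "(\<Union>r\<in>S. {\<omega>\<in>space M. X \<omega> = r}) = {\<omega>\<in>space M. X \<omega> \<in> S}" by auto
  ultimately show ?thesis by simp
qed

text \<open>The expectations in the theorem depend on each random element only through its law, so
  the estimates can be made for weight functions and the measure spaces disappear.\<close>

lemma (in prob_space) balanced_imp_balanced_weights:
  fixes X :: "'a \<Rightarrow> 'r::nontriv mod_ring"
  assumes "X \<in> measurable M (count_space UNIV)" "balanced p \<alpha> M X"
  shows "balanced_weights p \<alpha> (\<lambda>r. prob {\<omega>\<in>space M. X \<omega> = r})"
proof -
  have "prob {\<omega>\<in>space M. X \<omega> \<in> UNIV} = 1"
    by (simp add: prob_space)
  with assms(2) show ?thesis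
    unfolding balanced_weights_def balanced_def prob_finite_preimage[OF assms(1)] by simp
qed

lemma (in prob_space) expectation_zeta_pow:
  fixes X :: "'a \<Rightarrow> 'r::nontriv mod_ring"
  assumes "X \<in> measurable M (count_space UNIV)"
  shows "(\<integral>\<omega>. zeta_pow (t * X \<omega>) \<partial>M) = char_fun (\<lambda>r. prob {\<omega>\<in>space M. X \<omega> = r}) t"
  unfolding char_fun_def using expectation_finite_sum[OF assms, of "\<lambda>r. zeta_pow (t * r)"] .

subsection \<open>Averages of affine phases\<close>

lemma affine_map_on_add:
  assumes "affine_map_on H f" "affine_map_on H g"
  shows "affine_map_on H (\<lambda>h. f h + g h)"
proof -
  obtain \<phi> c \<psi> e where
    *: "\<forall>x\<in>H. \<forall>y\<in>H. \<phi> (x + y) = \<phi> x + \<phi> y" "\<forall>x\<in>H. f x = \<phi> x + c"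
       "\<forall>x\<in>H. \<forall>y\<in>H. \<psi> (x + y) = \<psi> x + \<psi> y" "\<forall>x\<in>H. g x = \<psi> x + e"
    using assms unfolding affine_map_on_def by metis
  then show ?thesis
    unfolding affine_map_on_def
    by (intro exI[of _ "\<lambda>x. \<phi> x + \<psi> x"] exI[of _ "c + e"]) (simp add: algebra_simps)
qed

lemma affine_map_on_mult_right:
  assumes "affine_map_on H f"
  shows "affine_map_on H (\<lambda>h. f h * r)"
proof -
  obtain \<phi> c where
    *: "\<forall>x\<in>H. \<forall>y\<in>H. \<phi> (x + y) = \<phi> x + \<phi> y" "\<forall>x\<in>H. f x = \<phi> x + c"
    using assms unfolding affine_map_on_def by metis
  then show ?thesis
    unfolding affine_map_on_def
    by (intro exI[of _ "\<lambda>x. \<phi> x * r"] exI[of _ "c * r"]) (simp add: algebra_simps)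
qed

lemma constant_on_imp_affine_map_on: "f constant_on H \<Longrightarrow> affine_map_on H f"
  unfolding affine_map_on_def constant_on_def
  by (elim exE, rule exI[of _ "\<lambda>_. 0"]) auto

text \<open>Translation by some \<open>a\<close> with \<open>\<phi> a \<noteq> 0\<close> permutes
  \<open>H\<close> and multiplies the sum by \<open>zeta_pow (\<phi> a)\<close>, which is not
  1.\<close>

lemma sum_zeta_pow_affine_eq_0:
  fixes F :: "'v::{finite,ab_group_add} \<Rightarrow> 'r::nontriv mod_ring"
  assumes H: "is_subgroup H" and F: "affine_map_on H F" "\<not> F constant_on H"
  shows "(\<Sum>h\<in>H. zeta_pow (F h)) = 0"
proof -
  obtain \<phi> c where
    *: "\<And>x y. x\<in>H \<Longrightarrow> y\<in>H \<Longrightarrow> \<phi> (x + y) = \<phi> x + \<phi> y" "\<And>x. x\<in>H \<Longrightarrow> F x = \<phi> x + c"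
    using F unfolding affine_map_on_def by metis
  obtain a where a: "a \<in> H" "\<phi> a \<noteq> 0"
  proof (rule ccontr)
    assume "\<not> thesis"
    then have "\<And>a. a \<in> H \<Longrightarrow> F a = c" using that *(2) by fastforce
    then show False using F(2) unfolding constant_on_def by blast
  qed
  have "(\<Sum>h\<in>H. zeta_pow (F h)) = (\<Sum>h\<in>H. zeta_pow (F (a + h)))"
    using H a by (intro sum.reindex_bij_witness[of _ "\<lambda>h. a + h" "\<lambda>h. - a + h"])
      (auto simp: is_subgroup_def simp del: uminus_add_conv_diff)
  also have "\<dots> = (\<Sum>h\<in>H. zeta_pow (\<phi> a) * zeta_pow (F h))"
    using H a * by (intro sum.cong refl) (auto simp: is_subgroup_def zeta_pow_add[symmetric] algebra_simps)
  also have "\<dots> = zeta_pow (\<phi> a) * (\<Sum>h\<in>H. zeta_pow (F h))"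
    by (simp add: sum_distrib_left)
  finally have "(1 - zeta_pow (\<phi> a)) * (\<Sum>h\<in>H. zeta_pow (F h)) = 0"
    by (simp add: algebra_simps)
  then show ?thesis using a by simp
qed

lemma norm_sum_zeta_pow_le: "cmod (\<Sum>h\<in>H. zeta_pow (F h)) \<le> real (card H)"
  using norm_sum[of "\<lambda>h. zeta_pow (F h)" H] by simp

text \<open>Two different unit vectors have a sum of modulus below 2 by the parallelogram law; the
  remaining terms contribute at most 1 each.\<close>

lemma norm_sum_zeta_pow_nonconst_less:
  fixes F :: "'v::finite \<Rightarrow> 'r::nontriv mod_ring"
  assumes "\<not> F constant_on H"
  shows "cmod (\<Sum>h\<in>H. zeta_pow (F h)) < real (card H)"
proof -
  obtain a b where ab: "a \<in> H" "b \<in> H" "F a \<noteq> F b"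
    using assms unfolding constant_on_def by metis
  have card: "card H = card (H - {a, b}) + 2"
  proof -
    have "card (H - {a,b}) = card H - card {a,b}" using ab by (intro card_Diff_subset) auto
    moreover have "card {a,b} = 2" using ab by (intro card_2_iff[THEN iffD2]) auto
    moreover have "card {a,b} \<le> card H" using ab by (intro card_mono) auto
    ultimately show ?thesis by simp
  qed
  have "(\<Sum>h\<in>H. zeta_pow (F h)) = (\<Sum>h\<in>H - {a, b}. zeta_pow (F h)) + (\<Sum>h\<in>{a, b}. zeta_pow (F h))"
    using ab by (intro sum.subset_diff) auto
  also have "(\<Sum>h\<in>{a, b}. zeta_pow (F h)) = zeta_pow (F a) + zeta_pow (F b)"
    using ab by (subst sum.insert) auto
  finally have "cmod (\<Sum>h\<in>H. zeta_pow (F h)) \<le> real (card (H - {a, b})) + cmod (zeta_pow (F a) + zeta_pow (F b))"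
    using norm_sum_zeta_pow_le[of F "H - {a, b}"]
      norm_triangle_ineq[of "\<Sum>h\<in>H - {a, b}. zeta_pow (F h)" "zeta_pow (F a) + zeta_pow (F b)"] by simp
  moreover have "cmod (zeta_pow (F a) + zeta_pow (F b)) < 2"
  proof -
    have "zeta_pow (F a) \<noteq> zeta_pow (F b)" using ab by (simp add: zeta_pow_eq_iff)
    then have pos: "(cmod (zeta_pow (F a) - zeta_pow (F b)))\<^sup>2 > 0" by simp
    have "(cmod (zeta_pow (F a) + zeta_pow (F b)))\<^sup>2 + (cmod (zeta_pow (F a) - zeta_pow (F b)))\<^sup>2
        = 2 * (cmod (zeta_pow (F a)))\<^sup>2 + 2 * (cmod (zeta_pow (F b)))\<^sup>2"
      by (simp only: cmod_power2) (simp add: power2_eq_square algebra_simps)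
    also have "\<dots> = 2\<^sup>2" by simp
    finally have "(cmod (zeta_pow (F a) + zeta_pow (F b)))\<^sup>2 < 2\<^sup>2"
      using pos by linarith
    then show ?thesis by (rule power2_less_imp_less) simp
  qed
  ultimately show ?thesis using card by simp
qed

text \<open>There are only finitely many pairs of a set and a phase, so the strict inequality above
  holds with one common constant. No algebraic structure of \<open>F\<close> enters, so this serves
  for phases that are not affine.\<close>

lemma uniform_nonconst_bound:
  "\<exists>\<rho>::real. 0 \<le> \<rho> \<and> \<rho> < 1 \<and> (\<forall>H (F :: 'v::finite \<Rightarrow> 'r::nontriv mod_ring). \<not> F constant_on H \<longrightarrow>
     cmod (\<Sum>h\<in>H. zeta_pow (F h)) \<le> \<rho> * real (card H))"
proof -
  let ?q = "\<lambda>(H, F :: 'v \<Rightarrow> 'r mod_ring). cmod (\<Sum>h\<in>H. zeta_pow (F h)) / real (card H)"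
  let ?S = "insert 0 (?q ` {(H, F). \<not> F constant_on H})"
  have fin: "finite ?S" by simp
  have pos: "card H > 0" if "\<not> F constant_on H" for H and F :: "'v \<Rightarrow> 'r mod_ring"
    using that by (auto simp: card_gt_0_iff constant_on_def)
  have "?q (H, F) < 1" if "\<not> F constant_on H" for H and F :: "'v \<Rightarrow> 'r mod_ring"
    using norm_sum_zeta_pow_nonconst_less[OF that] pos[OF that] by simp
  then have "Max ?S < 1" by (subst Max_less_iff[OF fin]) auto
  moreover have "Max ?S \<ge> 0" by (rule Max_ge[OF fin]) simp
  moreover have "cmod (\<Sum>h\<in>H. zeta_pow (F h)) \<le> Max ?S * real (card H)" if "\<not> F constant_on H"
    for H and F :: "'v \<Rightarrow> 'r mod_ring"
  proof -
    have "?q (H, F) \<le> Max ?S" using that by (intro Max_ge[OF fin]) auto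
    then show ?thesis using pos[OF that] by (simp add: divide_le_eq)
  qed
  ultimately show ?thesis by (intro exI[of _ "Max ?S"]) blast
qed

text \<open>In the application \<open>f r\<close> is the mass of the phases that become constant
  after a shift by \<open>r\<close>, and shifts in different residue classes cannot both make one
  phase constant. If the maximum \<open>M\<close> exceeds 1/2, all values outside its class are at
  most \<open>1 - M\<close>. That class has weight at most \<open>1 - \<alpha>\<close>, so the mean
  is at most \<open>\<alpha> + (1 - 2 * \<alpha>) * M\<close>, which increases with \<open>M\<close>
  because \<alpha> \<le> 1/2.\<close>

lemma mixture_concentration_step:
  fixes f :: "'r::nontriv mod_ring \<Rightarrow> real"
  assumes p: "prime p" and w: "balanced_weights p \<alpha> w" and \<alpha>: "0 \<le> \<alpha>" "\<alpha> \<le> 1/2"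
    and f: "\<And>r. f r \<le> 1 - s"
    and disj: "\<And>r r'. reduce_mod p r \<noteq> reduce_mod p r' \<Longrightarrow> f r + f r' \<le> 1"
  shows "(\<Sum>r\<in>UNIV. w r * f r) \<le> max (1/2) (1 - s - \<alpha> * (1 - 2 * s))"
proof -
  have w0: "0 \<le> w r" for r using w by (simp add: balanced_weights_def)
  have w1: "(\<Sum>r\<in>UNIV. w r) = 1" using w by (simp add: balanced_weights_def)
  define M where "M = Max (range f)"
  have fM: "f r \<le> M" for r unfolding M_def by (intro Max_ge) auto
  have "M \<in> range f" unfolding M_def by (intro Max_in) auto
  then obtain r0 where r0: "f r0 = M" by auto
  show ?thesis
  proof (cases "M \<le> 1/2")
    case True
    have "(\<Sum>r\<in>UNIV. w r * f r) \<le> (\<Sum>r\<in>UNIV. w r * (1/2))"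
      using w0 order_trans[OF fM True] by (intro sum_mono mult_left_mono)
    also have "\<dots> = 1/2" using w1 by (simp flip: sum_divide_distrib)
    finally show ?thesis by simp
  next
    case False
    let ?C = "{r. reduce_mod p r = reduce_mod p r0}"
    have C: "sum w ?C \<le> 1 - \<alpha>"
      by (rule balanced_weights_class_le[OF p w]) auto
    have "(\<Sum>r\<in>UNIV. w r * f r) \<le> (\<Sum>r\<in>UNIV. (1 - M) * w r + (2 * M - 1) * (if r \<in> ?C then w r else 0))"
    proof (intro sum_mono)
      fix r
      show "w r * f r \<le> (1 - M) * w r + (2 * M - 1) * (if r \<in> ?C then w r else 0)"
      proof (cases "r \<in> ?C")
        case True
        then show ?thesis using mult_left_mono[OF fM w0, of r] by (simp add: algebra_simps)
      next
        case False
        then have "f r \<le> 1 - M" using disj[of r r0] r0 by simp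
        then show ?thesis using False mult_left_mono[OF _ w0, of "f r" "1 - M" r] by (simp add: algebra_simps)
      qed
    qed
    also have "\<dots> = (1 - M) + (2 * M - 1) * sum w ?C"
      by (simp add: sum.distrib sum_distrib_left[symmetric] w1 sum.If_cases)
    also have "\<dots> \<le> (1 - M) + (2 * M - 1) * (1 - \<alpha>)"
      using C False by (intro add_left_mono mult_left_mono) auto
    also have "\<dots> = \<alpha> + (1 - 2 * \<alpha>) * M" by (simp add: algebra_simps)
    also have "\<dots> \<le> \<alpha> + (1 - 2 * \<alpha>) * (1 - s)"
      using f[of r0] r0 \<alpha> by (intro add_left_mono mult_left_mono) auto
    also have "\<dots> = 1 - s - \<alpha> * (1 - 2 * s)" by (simp add: algebra_simps)
    finally show ?thesis by simp
  qed
qed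

text \<open>The left side is the mean of \<open>X\<close> under the law of
  \<open>\<lambda>h. F h + v h * r\<close> for independent \<open>F\<close> and \<open>r\<close>
  with laws \<mu> and \<open>w\<close>. A vector-valued \<open>X\<close> covers the total mass, the
  phases and the mass of constant phases alike.\<close>

lemma sum_convolution:
  fixes X :: "('v::finite \<Rightarrow> 'r::nontriv mod_ring) \<Rightarrow> 'c::real_vector"
  shows "(\<Sum>F\<in>UNIV. (\<Sum>r\<in>UNIV. w r * \<mu> (\<lambda>h. F h - v h * r)) *\<^sub>R X F) =
         (\<Sum>r\<in>UNIV. w r *\<^sub>R (\<Sum>F\<in>UNIV. \<mu> F *\<^sub>R X (\<lambda>h. F h + v h * r)))"
proof -
  have "(\<Sum>F\<in>UNIV. (\<Sum>r\<in>UNIV. w r * \<mu> (\<lambda>h. F h - v h * r)) *\<^sub>R X F) =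
        (\<Sum>r\<in>UNIV. w r *\<^sub>R (\<Sum>F\<in>UNIV. \<mu> (\<lambda>h. F h - v h * r) *\<^sub>R X F))"
    unfolding scaleR_sum_left scaleR_sum_right by (subst sum.swap) simp
  moreover have "(\<Sum>F\<in>UNIV. \<mu> (\<lambda>h. F h - v h * r) *\<^sub>R X F) = (\<Sum>F\<in>UNIV. \<mu> F *\<^sub>R X (\<lambda>h. F h + v h * r))" for r
    by (rule sum.reindex_bij_witness[of _ "\<lambda>F h. F h + v h * r" "\<lambda>F h. F h - v h * r"]) auto
  ultimately show ?thesis by simp
qed

text \<open>Expanding every factor over its weights turns the product into the mean of
  \<open>zeta_pow (F h)\<close>, where \<open>F\<close> is the sum of the \<open>v j\<close> times
  independent elements with laws \<open>w j\<close>, and \<mu> is the law of \<open>F\<close>.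
  Concentration is bounded for every shift \<open>F\<^sub>0\<close>, because the induction moves the
  new term \<open>v j h * r\<close> into the shift. If the mass missing from the constant phases is
  \<open>s\<close>, a new factor adds at least \<open>\<alpha> * (1 - 2 * s)\<close> until the bound
  1/2 is reached; capping \<open>s\<close> at \<eta> makes this gain uniform.\<close>

lemma affine_product_mixture:
  fixes w :: "'j \<Rightarrow> 'r::nontriv mod_ring \<Rightarrow> real"
    and v :: "'j \<Rightarrow> 'v::{finite,ab_group_add} \<Rightarrow> 'r mod_ring"
  assumes p: "prime p" "CARD('r) = p ^ d" and \<alpha>: "0 \<le> \<alpha>" "\<alpha> \<le> 1/2" and \<eta>: "0 \<le> \<eta>" "\<eta> \<le> 1/2"
    and A: "finite A" "\<And>j. j \<in> A \<Longrightarrow> balanced_weights p \<alpha> (w j)"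
      "\<And>j. j \<in> A \<Longrightarrow> nonconst_affine_map_on H (v j)"
  shows "\<exists>\<mu> :: ('v \<Rightarrow> 'r mod_ring) \<Rightarrow> real. (\<forall>F. 0 \<le> \<mu> F) \<and> (\<Sum>F\<in>UNIV. \<mu> F) = 1 \<and>
     (\<forall>h. (\<Prod>j\<in>A. char_fun (w j) (v j h)) = (\<Sum>F\<in>UNIV. \<mu> F *\<^sub>R zeta_pow (F h))) \<and>
     (\<forall>F. \<mu> F \<noteq> 0 \<longrightarrow> affine_map_on H F) \<and>
     (\<forall>F\<^sub>0. (\<Sum>F\<in>UNIV. \<mu> F *\<^sub>R of_bool ((\<lambda>h. F h + F\<^sub>0 h) constant_on H)) \<le>
        1 - min \<eta> (real (card A) * (\<alpha> * (1 - 2 * \<eta>))))"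
  using A
proof (induction A rule: finite_induct)
  case empty
  \<comment> \<open>The empty product is represented by the point mass at the zero phase.\<close>
  define \<mu> where "\<mu> F = (if F = (\<lambda>h. 0) then 1 else 0::real)" for F :: "'v \<Rightarrow> 'r mod_ring"
  have s: "(\<Sum>F\<in>UNIV. \<mu> F *\<^sub>R X F) = X (\<lambda>h. 0)" for X :: "_ \<Rightarrow> 'c::real_vector"
    unfolding \<mu>_def by (simp add: if_distrib[of "\<lambda>c. c *\<^sub>R _"] cong: if_cong)
  have "(\<Sum>F\<in>UNIV. \<mu> F) = 1" using s[of "\<lambda>_. 1::real"] by simp
  moreover have "affine_map_on H (\<lambda>h. 0 :: 'r mod_ring)"
    by (rule constant_on_imp_affine_map_on) (auto simp: constant_on_def)
  moreover have "\<mu> F \<noteq> 0 \<Longrightarrow> F = (\<lambda>h. 0)" "0 \<le> \<mu> F" for F by (auto simp: \<mu>_def split: if_splits)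
  ultimately show ?case
    using \<eta> by (intro exI[of _ \<mu>]) (auto simp: s simp del: real_scaleR_def)
next
  case (insert j A)
  then obtain \<mu> :: "('v \<Rightarrow> 'r mod_ring) \<Rightarrow> real" where
    \<mu>: "\<And>F. 0 \<le> \<mu> F" "(\<Sum>F\<in>UNIV. \<mu> F) = 1"
     "\<And>h. (\<Prod>j\<in>A. char_fun (w j) (v j h)) = (\<Sum>F\<in>UNIV. \<mu> F *\<^sub>R zeta_pow (F h))"
     "\<And>F. \<mu> F \<noteq> 0 \<Longrightarrow> affine_map_on H F"
     "\<And>F\<^sub>0. (\<Sum>F\<in>UNIV. \<mu> F *\<^sub>R of_bool ((\<lambda>h. F h + F\<^sub>0 h) constant_on H)) \<le>
        1 - min \<eta> (real (card A) * (\<alpha> * (1 - 2 * \<eta>)))"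
    by (auto simp del: real_scaleR_def)
  have w: "balanced_weights p \<alpha> (w j)" and v: "affine_map_on H (v j)" "\<not> v j constant_on H"
    using insert.prems by (auto simp: nonconst_affine_map_on_def)
  have w0: "0 \<le> w j r" for r using w by (simp add: balanced_weights_def)
  have w1: "(\<Sum>r\<in>UNIV. w j r) = 1" using w by (simp add: balanced_weights_def)
  \<comment> \<open>The law of the old phase plus the independent new term
    \<open>v j h * r\<close>.\<close>
  define \<nu> where "\<nu> F = (\<Sum>r\<in>UNIV. w j r * \<mu> (\<lambda>h. F h - v j h * r))" for F
  have conv: "(\<Sum>F\<in>UNIV. \<nu> F *\<^sub>R X F) =
         (\<Sum>r\<in>UNIV. w j r *\<^sub>R (\<Sum>F\<in>UNIV. \<mu> F *\<^sub>R X (\<lambda>h. F h + v j h * r)))" for X :: "_ \<Rightarrow> 'c::real_vector"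
    unfolding \<nu>_def by (rule sum_convolution)
  have 1: "0 \<le> \<nu> F" for F unfolding \<nu>_def using w0 \<mu>(1) by (intro sum_nonneg) simp
  have 2: "(\<Sum>F\<in>UNIV. \<nu> F) = 1" using conv[of "\<lambda>_. 1::real"] by (simp add: \<mu>(2) w1)
  have 3: "(\<Prod>j\<in>insert j A. char_fun (w j) (v j h)) = (\<Sum>F\<in>UNIV. \<nu> F *\<^sub>R zeta_pow (F h))" for h
    unfolding conv prod.insert[OF insert.hyps] \<mu>(3)
    by (simp add: char_fun_def zeta_pow_add scaleR_conv_of_real sum_distrib_left sum_distrib_right mult_ac)
  have 4: "affine_map_on H F" if F: "\<nu> F \<noteq> 0" for F
  proof -
    obtain r where "\<mu> (\<lambda>h. F h - v j h * r) \<noteq> 0"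
      using F unfolding \<nu>_def by (metis (no_types, lifting) mult_zero_right sum.neutral)
    then have "affine_map_on H (\<lambda>h. (F h - v j h * r) + v j h * r)"
      using \<mu>(4) v by (intro affine_map_on_add affine_map_on_mult_right) auto
    then show ?thesis by simp
  qed
  have 5: "(\<Sum>F\<in>UNIV. \<nu> F *\<^sub>R of_bool ((\<lambda>h. F h + F\<^sub>0 h) constant_on H)) \<le>
        1 - min \<eta> (real (card (insert j A)) * (\<alpha> * (1 - 2 * \<eta>)))" for F\<^sub>0
  proof -
    define s where "s = min \<eta> (real (card A) * (\<alpha> * (1 - 2 * \<eta>)))"
    define f where "f r = (\<Sum>F\<in>UNIV. \<mu> F * of_bool ((\<lambda>h. F h + (v j h * r + F\<^sub>0 h)) constant_on H))" for r
    have "(\<Sum>F\<in>UNIV. \<nu> F *\<^sub>R (of_bool ((\<lambda>h. F h + F\<^sub>0 h) constant_on H) :: real)) = (\<Sum>r\<in>UNIV. w j r * f r)"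
      unfolding conv f_def by (simp add: add.assoc)
    also have "\<dots> \<le> max (1/2) (1 - s - \<alpha> * (1 - 2 * s))"
    proof (rule mixture_concentration_step[OF p(1) w \<alpha>])
      show "f r \<le> 1 - s" for r
        using \<mu>(5)[of "\<lambda>h. v j h * r + F\<^sub>0 h"] by (simp add: f_def s_def)
      show "f r + f r' \<le> 1" if ne: "reduce_mod p r \<noteq> reduce_mod p r'" for r r'
      proof -
        have "f r + f r' \<le> (\<Sum>F\<in>UNIV. \<mu> F)"
          unfolding f_def sum.distrib[symmetric] distrib_left[symmetric]
        proof (intro sum_mono)
          fix F
          have "\<not> ((\<lambda>h. F h + (v j h * r + F\<^sub>0 h)) constant_on H \<and> (\<lambda>h. F h + (v j h * r' + F\<^sub>0 h)) constant_on H)"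
          proof
            assume "(\<lambda>h. F h + (v j h * r + F\<^sub>0 h)) constant_on H \<and> (\<lambda>h. F h + (v j h * r' + F\<^sub>0 h)) constant_on H"
            then obtain a b where ab: "\<And>h. h \<in> H \<Longrightarrow> F h + (v j h * r + F\<^sub>0 h) = a" 
              "\<And>h. h \<in> H \<Longrightarrow> F h + (v j h * r' + F\<^sub>0 h) = b" unfolding constant_on_def by metis
            obtain x y where xy: "x \<in> H" "y \<in> H" "v j x \<noteq> v j y"
              using v(2) unfolding constant_on_def by metis
            \<comment> \<open>Subtracting the two constants eliminates \<open>F\<close> and
              \<open>F\<^sub>0\<close>. At two points separated by \<open>v j\<close> this produces
              a vanishing product, which forces equal residues of \<open>r\<close> and
              \<open>r'\<close>.\<close>
            have "v j h * (r - r') = a - b" if "h \<in> H" for h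
              using ab[OF that] by (auto simp: algebra_simps)
            then have "(v j x - v j y) * (r - r') = 0"
              using xy by (simp add: left_diff_distrib)
            then show False
              using reduce_mod_eq_if_mult_diff_eq_0[OF p, of "v j x - v j y" r r'] xy ne by simp
          qed
          then show "\<mu> F * (of_bool ((\<lambda>h. F h + (v j h * r + F\<^sub>0 h)) constant_on H) + 
             of_bool ((\<lambda>h. F h + (v j h * r' + F\<^sub>0 h)) constant_on H)) \<le> \<mu> F"
            using \<mu>(1)[of F] by (auto simp: of_bool_def)
        qed
        then show ?thesis using \<mu>(2) by simp
      qed
    qed
    also have "\<dots> \<le> 1 - min \<eta> (real (card (insert j A)) * (\<alpha> * (1 - 2 * \<eta>)))"
    proof -
      have "\<alpha> * (1 - 2 * \<eta>) \<le> \<alpha> * (1 - 2 * s)"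
        using \<alpha> by (intro mult_left_mono) (auto simp: s_def)
      moreover have "0 \<le> \<alpha> * (1 - 2 * \<eta>)" using \<alpha> \<eta> by simp
      moreover have "real (card (insert j A)) * (\<alpha> * (1 - 2 * \<eta>)) =
        real (card A) * (\<alpha> * (1 - 2 * \<eta>)) + \<alpha> * (1 - 2 * \<eta>)"
        using insert.hyps by (simp add: distrib_right)
      ultimately have "1 - s - \<alpha> * (1 - 2 * s) \<le> 1 - min \<eta> (real (card (insert j A)) * (\<alpha> * (1 - 2 * \<eta>)))"
        unfolding s_def by linarith
      then show ?thesis using \<eta> by auto
    qed
    finally show ?thesis .
  qed
  show ?case
    using 1 2 3 4 5 by (intro exI[of _ \<nu>]) blast
qed

text \<open>The phase \<open>F\<^sub>0\<close> is arbitrary. If it is affine on \<open>H\<close>,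
  all total phases \<open>F + F\<^sub>0\<close> of positive mass are affine, and only the constant
  ones survive summation; their mass is bounded by the mixture lemma. If it is not affine, no such
  total phase can be constant, since subtracting \<open>F\<close> would make
  \<open>F\<^sub>0\<close> affine, and \<rho> applies to all of them.\<close>

lemma norm_sum_affine_product_le:
  fixes w :: "'j \<Rightarrow> 'r::nontriv mod_ring \<Rightarrow> real"
    and v :: "'j \<Rightarrow> 'v::{finite,ab_group_add} \<Rightarrow> 'r mod_ring" and F\<^sub>0 :: "'v \<Rightarrow> 'r mod_ring"
  assumes p: "prime p" "CARD('r) = p ^ d" and \<alpha>: "0 \<le> \<alpha>" "\<alpha> \<le> 1/2" and \<eta>: "0 \<le> \<eta>" "\<eta> \<le> 1/2"
    and A: "finite A" "\<And>j. j \<in> A \<Longrightarrow> balanced_weights p \<alpha> (w j)"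
      "\<And>j. j \<in> A \<Longrightarrow> nonconst_affine_map_on H (v j)"
    and H: "is_subgroup H"
    and \<rho>: "\<And>F :: 'v \<Rightarrow> 'r mod_ring. \<not> F constant_on H \<Longrightarrow> cmod (\<Sum>h\<in>H. zeta_pow (F h)) \<le> \<rho> * real (card H)"
  shows "cmod (\<Sum>h\<in>H. zeta_pow (F\<^sub>0 h) * (\<Prod>j\<in>A. char_fun (w j) (v j h))) \<le>
     real (card H) * max \<rho> (1 - min \<eta> (real (card A) * (\<alpha> * (1 - 2 * \<eta>))))"
proof -
  obtain \<mu> :: "('v \<Rightarrow> 'r mod_ring) \<Rightarrow> real" where
    \<mu>: "\<And>F. 0 \<le> \<mu> F" "(\<Sum>F\<in>UNIV. \<mu> F) = 1"
     "\<And>h. (\<Prod>j\<in>A. char_fun (w j) (v j h)) = (\<Sum>F\<in>UNIV. \<mu> F *\<^sub>R zeta_pow (F h))"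
     "\<And>F. \<mu> F \<noteq> 0 \<Longrightarrow> affine_map_on H F"
     "\<And>F\<^sub>0. (\<Sum>F\<in>UNIV. \<mu> F *\<^sub>R of_bool ((\<lambda>h. F h + F\<^sub>0 h) constant_on H)) \<le>
        1 - min \<eta> (real (card A) * (\<alpha> * (1 - 2 * \<eta>)))"
    using affine_product_mixture[where w = w and v = v, OF p \<alpha> \<eta> A] by blast
  define S where "S F = (\<Sum>h\<in>H. zeta_pow (F h + F\<^sub>0 h))" for F
  have "(\<Sum>h\<in>H. zeta_pow (F\<^sub>0 h) * (\<Prod>j\<in>A. char_fun (w j) (v j h))) = (\<Sum>F\<in>UNIV. \<mu> F *\<^sub>R S F)"
    unfolding \<mu>(3) S_def scaleR_sum_right sum_distrib_left
    by (subst sum.swap) (simp add: zeta_pow_add mult_ac)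
  then have le: "cmod (\<Sum>h\<in>H. zeta_pow (F\<^sub>0 h) * (\<Prod>j\<in>A. char_fun (w j) (v j h))) \<le> (\<Sum>F\<in>UNIV. \<mu> F * cmod (S F))"
    using norm_sum[of "\<lambda>F. \<mu> F *\<^sub>R S F" UNIV] \<mu>(1) by simp
  show ?thesis
  proof (cases "affine_map_on H F\<^sub>0")
    case True
    have "\<mu> F * cmod (S F) \<le> real (card H) * (\<mu> F *\<^sub>R of_bool ((\<lambda>h. F h + F\<^sub>0 h) constant_on H))" for F
    proof (cases "\<mu> F = 0 \<or> (\<lambda>h. F h + F\<^sub>0 h) constant_on H")
      case True
      then show ?thesis
        using mult_left_mono[OF norm_sum_zeta_pow_le[of "\<lambda>h. F h + F\<^sub>0 h" H] \<mu>(1)[of F]]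
        by (auto simp: S_def mult_ac)
    next
      case False
      then have "S F = 0"
        unfolding S_def using True \<mu>(4)
        by (intro sum_zeta_pow_affine_eq_0[OF H] affine_map_on_add) auto
      then show ?thesis using \<mu>(1) by simp
    qed
    then have "(\<Sum>F\<in>UNIV. \<mu> F * cmod (S F)) \<le>
        real (card H) * (\<Sum>F\<in>UNIV. \<mu> F *\<^sub>R of_bool ((\<lambda>h. F h + F\<^sub>0 h) constant_on H))"
      unfolding sum_distrib_left by (rule sum_mono)
    also have "\<dots> \<le> real (card H) * (1 - min \<eta> (real (card A) * (\<alpha> * (1 - 2 * \<eta>))))"
      by (intro mult_left_mono \<mu>(5)) auto
    also have "\<dots> \<le> real (card H) * max \<rho> (1 - min \<eta> (real (card A) * (\<alpha> * (1 - 2 * \<eta>))))"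
      by (intro mult_left_mono) auto
    finally show ?thesis using le by simp
  next
    case False
    have "\<mu> F * cmod (S F) \<le> \<mu> F * (\<rho> * real (card H))" for F
    proof (cases "\<mu> F = 0")
      case F: False
      have "\<not> (\<lambda>h. F h + F\<^sub>0 h) constant_on H"
      proof
        assume "(\<lambda>h. F h + F\<^sub>0 h) constant_on H"
        then have "affine_map_on H (\<lambda>h. (F h + F\<^sub>0 h) + F h * (-1))"
          by (rule affine_map_on_add[OF constant_on_imp_affine_map_on affine_map_on_mult_right[OF \<mu>(4)[OF F]]])
        with False show False by simp
      qed
      then show ?thesis unfolding S_def using \<mu>(1) by (intro mult_left_mono \<rho>)
    qed simp
    then have "(\<Sum>F\<in>UNIV. \<mu> F * cmod (S F)) \<le> (\<Sum>F\<in>UNIV. \<mu> F * (\<rho> * real (card H)))"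
      by (rule sum_mono)
    also have "\<dots> = real (card H) * \<rho>" using \<mu>(2) by (simp flip: sum_distrib_right)
    also have "\<dots> \<le> real (card H) * max \<rho> (1 - min \<eta> (real (card A) * (\<alpha> * (1 - 2 * \<eta>))))"
      by (intro mult_left_mono) auto
    finally show ?thesis using le by simp
  qed
qed

text \<open>Each extra factor is a mean of phases, and a phase can be absorbed into \<open>F\<close>
  because the bound on \<open>G\<close> is assumed for every phase. Hence factors with an arbitrary
  \<open>v\<close>, affine or not, cost nothing.\<close>

lemma norm_sum_char_fun_mult_le:
  fixes w :: "'j \<Rightarrow> 'r::nontriv mod_ring \<Rightarrow> real" and v :: "'j \<Rightarrow> 'v \<Rightarrow> 'r mod_ring"
    and F :: "'v \<Rightarrow> 'r mod_ring"
  assumes L: "finite L" "\<And>j. j \<in> L \<Longrightarrow> balanced_weights p \<alpha> (w j)"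
    and G: "\<And>F :: 'v \<Rightarrow> 'r mod_ring. cmod (\<Sum>h\<in>H. zeta_pow (F h) * G h) \<le> C"
  shows "cmod (\<Sum>h\<in>H. zeta_pow (F h) * ((\<Prod>j\<in>L. char_fun (w j) (v j h)) * G h)) \<le> C"
  using L
proof (induction L arbitrary: F rule: finite_induct)
  case empty
  then show ?case using G by simp
next
  case (insert j L)
  have w: "\<And>r. 0 \<le> w j r" "(\<Sum>r\<in>UNIV. w j r) = 1"
    using insert.prems[of j] by (auto simp: balanced_weights_def)
  let ?P = "\<lambda>h. (\<Prod>j\<in>L. char_fun (w j) (v j h)) * G h"
  have "(\<Sum>h\<in>H. zeta_pow (F h) * ((\<Prod>j\<in>insert j L. char_fun (w j) (v j h)) * G h)) =
      (\<Sum>h\<in>H. \<Sum>r\<in>UNIV. of_real (w j r) * (zeta_pow (F h + v j h * r) * ?P h))"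
    using insert.hyps
    by (simp add: char_fun_def sum_distrib_left sum_distrib_right zeta_pow_add mult_ac)
  also have "\<dots> = (\<Sum>r\<in>UNIV. of_real (w j r) * (\<Sum>h\<in>H. zeta_pow (F h + v j h * r) * ?P h))"
    by (subst sum.swap) (simp add: sum_distrib_left)
  also have "cmod \<dots> \<le> (\<Sum>r\<in>UNIV. w j r * C)"
  proof (rule order_trans[OF norm_sum sum_mono])
    fix r
    have "cmod (\<Sum>h\<in>H. zeta_pow (F h + v j h * r) * ?P h) \<le> C"
      using insert.prems by (intro insert.IH) auto
    then show "cmod (of_real (w j r) * (\<Sum>h\<in>H. zeta_pow (F h + v j h * r) * ?P h)) \<le> w j r * C"
      using w(1)[of r] by (simp add: norm_mult mult_left_mono)
  qed
  also have "\<dots> = C" using w(2) by (simp flip: sum_distrib_right)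
  finally show ?case .
qed

subsection \<open>Sums over small subsets\<close>

lemma sum_Pow_card_binomial:
  fixes a b :: real
  assumes "finite I"
  shows "(\<Sum>D\<in>Pow I. a ^ card D * b ^ (card I - card D)) = (a + b) ^ card I"
proof -
  have "(a + b) ^ card I = (\<Prod>i\<in>I. a + b)" by simp
  also have "\<dots> = (\<Sum>D\<in>Pow I. (\<Prod>i\<in>D. a) * (\<Prod>i\<in>I - D. b))"
    by (rule prod_add[OF assms])
  also have "\<dots> = (\<Sum>D\<in>Pow I. a ^ card D * b ^ (card I - card D))"
    using assms by (intro sum.cong refl) (auto simp: card_Diff_subset finite_subset)
  finally show ?thesis by simp
qed

text \<open>A Chernoff bound: for small \<open>D\<close> and \<open>s < 1\<close> one may insert the
  factor \<open>s powr (- \<delta>\<^sub>0 * n) * s ^ card D\<close>, which is at least 1, and then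
  sum over all subsets by the binomial formula. All thresholds below \<open>\<delta>\<^sub>0\<close>
  are covered, so that one value can later serve several sums.\<close>

lemma sum_small_subsets_tendsto_0:
  fixes \<rho> K :: real
  assumes \<rho>: "0 \<le> \<rho>" "\<rho> < 1" and K: "1 \<le> K"
  shows "\<exists>\<delta>\<^sub>0>0. \<forall>\<delta>\<le>\<delta>\<^sub>0. (\<lambda>n. \<Sum>D | D \<subseteq> {1..n::nat} \<and> real (card D) \<le> \<delta> * real n.
            K ^ card D * \<rho> ^ (n - card D)) \<longlonglongrightarrow> 0"
proof -
  \<comment> \<open>The value of \<open>s\<close> gives
    \<open>K * s + \<rho> = \<theta> < 1\<close>. Then \<open>\<delta>\<^sub>0\<close> is chosen
    with \<open>s powr (- \<delta>\<^sub>0)\<close> equal to the inverse square root of \<theta>, so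
    the resulting base \<open>q\<close> is the square root of \<theta>.\<close>
  define s where "s = (1 - \<rho>) / (2 * K)"
  define \<theta> where "\<theta> = (1 + \<rho>) / 2"
  have s: "0 < s" "s < 1" using \<rho> K by (auto simp: s_def field_simps)
  have \<theta>: "0 < \<theta>" "\<theta> < 1" using \<rho> by (auto simp: \<theta>_def)
  define \<delta>\<^sub>0 where "\<delta>\<^sub>0 = ln \<theta> / (2 * ln s)"
  define q where "q = s powr (- \<delta>\<^sub>0) * \<theta>"
  have \<delta>\<^sub>0: "\<delta>\<^sub>0 > 0" using s \<theta> by (auto simp: \<delta>\<^sub>0_def divide_neg_neg)
  have "q = exp (ln \<theta> / 2)"
  proof -
    have "s powr (- \<delta>\<^sub>0) = exp (- (ln \<theta> / 2))" using s by (simp add: powr_def \<delta>\<^sub>0_def)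
    then have "q = exp (- (ln \<theta> / 2)) * exp (ln \<theta>)" using \<theta> by (simp add: q_def)
    then show ?thesis by (simp flip: exp_add)
  qed
  then have q: "0 \<le> q" "q < 1" using \<theta> by auto
  have le: "(\<Sum>D | D \<subseteq> {1..n} \<and> real (card D) \<le> \<delta> * real n. K ^ card D * \<rho> ^ (n - card D)) \<le> q ^ n"
    if \<delta>: "\<delta> \<le> \<delta>\<^sub>0" for \<delta> and n :: nat
  proof -
    have "(\<Sum>D | D \<subseteq> {1..n} \<and> real (card D) \<le> \<delta> * real n. K ^ card D * \<rho> ^ (n - card D)) \<le>
      (\<Sum>D | D \<subseteq> {1..n} \<and> real (card D) \<le> \<delta> * real n. (s powr (- \<delta>\<^sub>0)) ^ n * ((K * s) ^ card D * \<rho> ^ (n - card D)))"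
    proof (rule sum_mono)
      fix D assume D: "D \<in> {D. D \<subseteq> {1..n} \<and> real (card D) \<le> \<delta> * real n}"
      have "real (card D) \<le> \<delta>\<^sub>0 * real n" using D \<delta> mult_right_mono[OF \<delta>, of "real n"] by auto
      then have "s powr (\<delta>\<^sub>0 * real n) \<le> s powr real (card D)"
        using s by (intro powr_mono') auto
      then have "(s powr \<delta>\<^sub>0) ^ n \<le> s ^ card D"
        using s by (simp add: powr_realpow powr_powr[symmetric])
      then have "1 \<le> (s powr (- \<delta>\<^sub>0)) ^ n * s ^ card D"
        using s by (simp add: powr_minus power_inverse field_simps)
      then have "(K ^ card D * \<rho> ^ (n - card D)) * 1 \<le> (K ^ card D * \<rho> ^ (n - card D)) * ((s powr (- \<delta>\<^sub>0)) ^ n * s ^ card D)"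
        using \<rho> K by (intro mult_left_mono) auto
      then show "K ^ card D * \<rho> ^ (n - card D) \<le> (s powr (- \<delta>\<^sub>0)) ^ n * ((K * s) ^ card D * \<rho> ^ (n - card D))"
        by (simp add: power_mult_distrib mult_ac)
    qed
    also have "\<dots> \<le> (\<Sum>D\<in>Pow {1..n}. (s powr (- \<delta>\<^sub>0)) ^ n * ((K * s) ^ card D * \<rho> ^ (n - card D)))"
      using s K \<rho> by (intro sum_mono2) auto
    also have "\<dots> = (s powr (- \<delta>\<^sub>0)) ^ n * (K * s + \<rho>) ^ n"
      using sum_Pow_card_binomial[of "{1..n}" "K * s" \<rho>] by (simp add: sum_distrib_left[symmetric])
    also have "K * s + \<rho> = \<theta>" using K by (simp add: s_def \<theta>_def field_simps)
    finally show ?thesis by (simp add: q_def power_mult_distrib)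
  qed
  have lim: "(\<lambda>n. q ^ n) \<longlonglongrightarrow> 0" using q by (intro LIMSEQ_power_zero) auto
  have "(\<lambda>n. \<Sum>D | D \<subseteq> {1..n::nat} \<and> real (card D) \<le> \<delta> * real n.
            K ^ card D * \<rho> ^ (n - card D)) \<longlonglongrightarrow> 0" if "\<delta> \<le> \<delta>\<^sub>0" for \<delta>
    using le[OF that] \<rho> K by (intro tendsto_sandwich[OF _ _ tendsto_const lim] always_eventually allI sum_nonneg) auto
  with \<delta>\<^sub>0 show ?thesis by blast
qed

text \<open>The sum is a binomial power minus the term of the empty set, hence at most
  \<open>exp (K * n powr (1 - c)) - 1\<close>. The exponent vanishes in the limit exactly because
  the power exceeds 1.\<close>

lemma sum_nonempty_subsets_powr_tendsto_0:
  fixes K c :: real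
  assumes "0 \<le> K" "1 < c"
  shows "(\<lambda>n. \<Sum>D | D \<subseteq> {1..n::nat} \<and> D \<noteq> {}. (K * real n powr (- c)) ^ card D) \<longlonglongrightarrow> 0"
proof -
  have eq: "(\<Sum>D | D \<subseteq> {1..n} \<and> D \<noteq> {}. x ^ card D) = (1 + x) ^ n - 1" for x :: real and n :: nat
  proof -
    have "{D. D \<subseteq> {1..n} \<and> D \<noteq> {}} = Pow {1..n} - {{}}" by auto
    then have "(\<Sum>D | D \<subseteq> {1..n} \<and> D \<noteq> {}. x ^ card D) = (\<Sum>D\<in>Pow {1..n}. x ^ card D) - 1"
      by (simp add: sum_diff1)
    then show ?thesis using sum_Pow_card_binomial[of "{1..n}" x 1] by (simp add: add.commute)
  qed
  have up: "(1 + K * real n powr (- c)) ^ n - 1 \<le> exp (real n * (K * real n powr (- c))) - 1" for n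
    using assms exp_ge_add_one_self[of "K * real n powr (- c)"]
      power_mono[of "1 + K * real n powr (- c)" "exp (K * real n powr (- c))" n]
    by (simp add: exp_of_nat_mult)
  have "(\<lambda>n. real n * (K * real n powr (- c))) \<longlonglongrightarrow> 0"
    using assms by real_asymp
  then have "(\<lambda>n. exp (real n * (K * real n powr (- c))) - 1) \<longlonglongrightarrow> exp 0 - 1"
    by (intro tendsto_intros)
  then have lim: "(\<lambda>n. exp (real n * (K * real n powr (- c))) - 1) \<longlonglongrightarrow> 0" by simp
  show ?thesis unfolding eq
    using up assms
    by (intro tendsto_sandwich[OF _ _ tendsto_const lim] always_eventually allI)
       (auto intro!: one_le_power)
qed

text \<open>The negative exponent is of order n log n, whereas \<open>K ^ n\<close> contributes only
  a linear one.\<close>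

lemma exponential_beats_tendsto_0:
  fixes K \<kappa> \<epsilon> :: real
  assumes "0 < K" "0 < \<kappa>" "0 < \<epsilon>"
  shows "(\<lambda>n. K ^ n * exp (- (\<kappa> * (\<epsilon> * real n - 1) * ln (real n)))) \<longlonglongrightarrow> 0"
proof -
  have "(\<lambda>n. exp (real n * ln K - \<kappa> * (\<epsilon> * real n - 1) * ln (real n))) \<longlonglongrightarrow> 0"
    using assms by real_asymp
  moreover have "exp (real n * ln K - \<kappa> * (\<epsilon> * real n - 1) * ln (real n)) = K ^ n * exp (- (\<kappa> * (\<epsilon> * real n - 1) * ln (real n)))" for n
    using assms by (simp add: diff_conv_add_uminus exp_add exp_of_nat_mult del: add_uminus_conv_diff)
  ultimately show ?thesis by simp
qed

subsection \<open>Tuples close to an isotropic set\<close>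

lemma sum_PiE_split:
  assumes "D \<subseteq> I"
  shows "(\<Sum>g\<in>PiE I (\<lambda>k. if k \<in> D then X else Y). f g) =
    (\<Sum>a\<in>PiE D (\<lambda>_. X). \<Sum>b\<in>PiE (I - D) (\<lambda>_. Y). f (\<lambda>k. if k \<in> D then a k else b k))"
  unfolding sum.cartesian_product
  using assms
  by (intro sum.reindex_bij_witness[of _ "\<lambda>(a, b). \<lambda>k. if k \<in> D then a k else b k"
        "\<lambda>g. (restrict g D, restrict g (I - D))"])
     (auto simp: PiE_def Pi_def extensional_def fun_eq_iff restrict_def split: if_splits intro!: arg_cong[of _ _ f])

text \<open>One fixed \<open>n\<close>, large enough for \<alpha> \<le> 1/2. \<open>P_cases\<close>
  treats both shapes of the index set together: either both orders of a pair occur, or one order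
  occurs and the symmetry of \<open>B\<close> supplies the other. The weights are constrained only
  on \<open>P\<close> and on the diagonal.\<close>

locale balanced_system =
  fixes p d n :: nat and \<alpha> :: real and P :: "(nat \<times> nat) set"
    and w :: "nat \<Rightarrow> nat \<Rightarrow> 'r::nontriv mod_ring \<Rightarrow> real"
    and U :: "'g::{finite,ab_group_add} \<times> 'g \<Rightarrow> 'r mod_ring"
    and B :: "'g \<times> 'g \<Rightarrow> 'g \<times> 'g \<Rightarrow> 'r mod_ring"
  assumes p: "prime p" "CARD('r) = p ^ d"
    and \<alpha>: "0 \<le> \<alpha>" "\<alpha> \<le> 1/2"
    and P_subset: "P \<subseteq> {1..n} \<times> {1..n}"
    and P_cases: "\<And>k l. k \<in> {1..n} \<Longrightarrow> l \<in> {1..n} \<Longrightarrow> k \<noteq> l \<Longrightarrow>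
      (k, l) \<in> P \<and> (l, k) \<in> P \<or> (symmetric_map B \<or> alternating_map B) \<and> ((k, l) \<in> P \<or> (l, k) \<in> P)"
    and w_diag: "\<And>k. k \<in> {1..n} \<Longrightarrow> balanced_weights p \<alpha> (w k k)"
    and w_P: "\<And>k l. (k, l) \<in> P \<Longrightarrow> balanced_weights p \<alpha> (w k l)"
    and cond_i: "condition_i B" and cond_ii: "condition_ii B"
begin

section \<open>The factors of one tuple\<close>

definition vertex :: "nat \<Rightarrow> 'g \<times> 'g \<Rightarrow> complex" where
  "vertex k a = char_fun (w k k) (U a)"

text \<open>The default value 1 off \<open>P\<close> lets the product run over the full square of
  indices, which splits along any subset of indices.\<close>

definition edge :: "nat \<Rightarrow> nat \<Rightarrow> 'g \<times> 'g \<Rightarrow> 'g \<times> 'g \<Rightarrow> complex" where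
  "edge k l a b = (if (k, l) \<in> P then char_fun (w k l) (B a b) else 1)"

definition summand :: "(nat \<Rightarrow> 'g \<times> 'g) \<Rightarrow> complex" where
  "summand g = (\<Prod>k\<in>{1..n}. vertex k (g k)) * (\<Prod>k\<in>{1..n}. \<Prod>l\<in>{1..n}. edge k l (g k) (g l))"

lemma summand_eq:
  "summand g = (\<Prod>k\<in>{1..n}. char_fun (w k k) (U (g k))) * (\<Prod>(k, l)\<in>P. char_fun (w k l) (B (g k) (g l)))"
proof -
  have "(\<Prod>k\<in>{1..n}. \<Prod>l\<in>{1..n}. edge k l (g k) (g l)) = (\<Prod>(k, l)\<in>{1..n} \<times> {1..n}. edge k l (g k) (g l))"
    by (rule prod.cartesian_product)
  also have "\<dots> = (\<Prod>(k, l)\<in>P. char_fun (w k l) (B (g k) (g l)))"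
    by (rule prod.mono_neutral_cong_right) (use P_subset in \<open>auto simp: edge_def\<close>)
  finally show ?thesis by (simp add: summand_def vertex_def)
qed

lemma norm_vertex_le_1: "k \<in> {1..n} \<Longrightarrow> cmod (vertex k a) \<le> 1"
  unfolding vertex_def using w_diag norm_char_fun_le_1 by blast

lemma norm_edge_le_1: "cmod (edge k l a b) \<le> 1"
  unfolding edge_def using w_P[THEN norm_char_fun_le_1] by auto

lemma norm_vertices_le_1: "S \<subseteq> {1..n} \<Longrightarrow> cmod (\<Prod>k\<in>S. vertex k (g k)) \<le> 1"
  unfolding prod_norm[symmetric] by (intro prod_le_1 conjI norm_vertex_le_1 norm_ge_zero) auto

lemma norm_edges_le_1: "cmod (\<Prod>k\<in>S. \<Prod>l\<in>T. edge k l (g k) (h l)) \<le> 1"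
  unfolding prod_norm[symmetric]
  by (intro prod_le_1 conjI norm_edge_le_1 norm_ge_zero prod_nonneg ballI)

lemma norm_summand_le_1: "cmod (summand g) \<le> 1"
  unfolding summand_def norm_mult
  using norm_vertices_le_1[of "{1..n}" g] norm_edges_le_1[where S = "{1..n}" and T = "{1..n}" and g = g and h = g]
  by (intro mult_le_one) auto

text \<open>Every ordered pair of distinct indices carrying \<open>v\<close> and \<open>v'\<close>
  lies, up to a swap, in the set \<open>Q\<close> of pairs with a nontrivial factor. Each factor
  from \<open>Q\<close> is at most \<open>exp (- (\<kappa> * \<alpha> / 2))\<close>, and the swap
  halves the count, which turns 2 into 4. The \<open>- 1\<close> removes the diagonal, which matters
  when \<open>v = v'\<close>.\<close>

lemma norm_summand_nonisotropic_le:
  assumes \<kappa>: "0 < \<kappa>" "\<And>t::'r mod_ring. t \<noteq> 0 \<Longrightarrow> Re (zeta_pow t) \<le> 1 - \<kappa>"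
    and v: "B v v' \<noteq> 0"
  shows "cmod (summand g) \<le>
    exp (- (\<kappa> * \<alpha> / 4 * (real (card {k\<in>{1..n}. g k = v}) * (real (card {k\<in>{1..n}. g k = v'}) - 1))))"
proof -
  let ?K = "{k\<in>{1..n}. g k = v}" and ?L = "{k\<in>{1..n}. g k = v'}"
  define Q where "Q = {(k, l)\<in>P. B (g k) (g l) \<noteq> 0}"
  define S where "S = Sigma ?K (\<lambda>k. ?L - {k})"
  have finP: "finite P" using P_subset finite_subset by blast
  have QP: "Q \<subseteq> P" by (auto simp: Q_def)
  have finQ: "finite Q" using QP finP finite_subset by blast
  have "S \<subseteq> Q \<union> prod.swap ` Q"
  proof
    fix x assume "x \<in> S"
    then obtain k l where x: "x = (k, l)" "k \<in> {1..n}" "l \<in> {1..n}" "k \<noteq> l" "g k = v" "g l = v'"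
      by (auto simp: S_def)
    have sym: "B v' v \<noteq> 0" if "symmetric_map B \<or> alternating_map B"
      using that v unfolding symmetric_map_def alternating_map_def by (metis neg_equal_0_iff_equal)
    have "(k, l) \<in> Q \<or> (l, k) \<in> Q"
      using P_cases[OF x(2-4)] sym v x by (auto simp: Q_def)
    then show "x \<in> Q \<union> prod.swap ` Q" using x by force
  qed
  then have "card S \<le> card (Q \<union> prod.swap ` Q)" using finQ by (intro card_mono) auto
  also have "\<dots> \<le> card Q + card (prod.swap ` Q)" by (rule card_Un_le)
  also have "\<dots> \<le> 2 * card Q" using card_image_le[OF finQ, of prod.swap] by simp
  finally have SQ: "real (card S) \<le> 2 * real (card Q)" by linarith
  have "real (card ?K) * (real (card ?L) - 1) = (\<Sum>k\<in>?K. real (card ?L) - 1)" by simp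
  also have "\<dots> \<le> (\<Sum>k\<in>?K. real (card (?L - {k})))"
  proof (rule sum_mono)
    fix k
    have "card ?L \<le> card (?L - {k}) + 1" using diff_card_le_card_Diff[of "{k}" ?L] by simp
    then show "real (card ?L) - 1 \<le> real (card (?L - {k}))" by linarith
  qed
  also have "\<dots> = real (card S)" unfolding S_def by (subst card_SigmaI) auto
  finally have KL: "real (card ?K) * (real (card ?L) - 1) \<le> 2 * real (card Q)" using SQ by simp
  have "cmod (summand g) \<le> cmod (\<Prod>(k, l)\<in>P. char_fun (w k l) (B (g k) (g l)))"
    using norm_vertices_le_1[of "{1..n}" g]
    by (simp add: summand_eq norm_mult vertex_def mult_left_le_one_le)
  also have "\<dots> = (\<Prod>x\<in>P. cmod (char_fun (w (fst x) (snd x)) (B (g (fst x)) (g (snd x)))))"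
    by (simp add: case_prod_beta prod_norm)
  also have "\<dots> \<le> (\<Prod>x\<in>P. if x \<in> Q then exp (- (\<kappa> * \<alpha> / 2)) else 1)"
  proof (rule prod_mono, safe)
    fix k l assume kl: "(k, l) \<in> P"
    show "cmod (char_fun (w (fst (k, l)) (snd (k, l))) (B (g (fst (k, l))) (g (snd (k, l))))) \<le> (if (k, l) \<in> Q then exp (- (\<kappa> * \<alpha> / 2)) else 1)"
    proof (cases "(k, l) \<in> Q")
      case True
      then have "B (g k) (g l) \<noteq> 0" by (simp add: Q_def)
      from norm_char_fun_le[OF p w_P[OF kl] this \<kappa>] show ?thesis
        using True exp_ge_add_one_self[of "- (\<kappa> * \<alpha> / 2)"] by simp
    qed (use norm_char_fun_le_1[OF w_P[OF kl]] in auto)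
  qed auto
  also have "\<dots> = exp (- (\<kappa> * \<alpha> / 2)) ^ card Q"
  proof -
    have "P \<inter> Q = Q" using QP by blast
    then show ?thesis using finP by (simp add: prod.If_cases)
  qed
  also have "\<dots> = exp (- (\<kappa> * \<alpha> / 2 * real (card Q)))"
    by (simp add: exp_of_nat_mult[symmetric] mult_ac)
  also have "\<dots> \<le> exp (- (\<kappa> * \<alpha> / 4 * (real (card ?K) * (real (card ?L) - 1))))"
    using mult_left_mono[OF KL, of "\<kappa> * \<alpha> / 4"] \<kappa>(1) \<alpha> by (simp add: mult_ac)
  finally show ?thesis .
qed

text \<open>Condition (ii) makes only one of the two maps affine and nonconstant, without saying
  which. The pair \<open>w1\<close>, \<open>v1\<close> names that factor; of \<open>v2\<close>
  nothing is claimed. If only one order lies in \<open>P\<close>, symmetry or antisymmetry makes the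
  occurring map affine and nonconstant, and \<open>v2 = 0\<close> gives a dummy factor 1.\<close>

lemma edge_pair_factors:
  assumes kl: "k \<in> {1..n}" "l \<in> {1..n}" "k \<noteq> l"
    and aff: "nonconst_affine_map_on H (\<lambda>x. B (g' + x) a) \<or> nonconst_affine_map_on H (\<lambda>x. B a (g' + x))"
  shows "\<exists>(w1 :: 'r mod_ring \<Rightarrow> real) v1 (w2 :: 'r mod_ring \<Rightarrow> real) v2. balanced_weights p \<alpha> w1 \<and> nonconst_affine_map_on H v1 \<and> balanced_weights p \<alpha> w2 \<and>
    (\<forall>h. edge k l (g' + h) a * edge l k a (g' + h) = char_fun w1 (v1 h) * char_fun w2 (v2 h))" (is ?thesis)
proof -
  have I: ?thesis if "balanced_weights p \<alpha> w1" "nonconst_affine_map_on H v1" "balanced_weights p \<alpha> w2"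
    "\<And>h. edge k l (g' + h) a * edge l k a (g' + h) = char_fun w1 (v1 h) * char_fun w2 (v2 h)"
    for w1 w2 :: "'r mod_ring \<Rightarrow> real" and v1 v2
    using that by blast
  show ?thesis
  proof (cases "(k, l) \<in> P \<and> (l, k) \<in> P")
    case True
    then have e: "edge k l x a * edge l k a x = char_fun (w k l) (B x a) * char_fun (w l k) (B a x)" for x
      by (simp add: edge_def)
    from aff show ?thesis
    proof
      assume "nonconst_affine_map_on H (\<lambda>x. B (g' + x) a)"
      then show ?thesis
        using True w_P by (intro I[of "w k l" "\<lambda>x. B (g' + x) a" "w l k" "\<lambda>x. B a (g' + x)"]) (auto simp: e)
    next
      assume "nonconst_affine_map_on H (\<lambda>x. B a (g' + x))"
      then show ?thesis
        using True w_P by (intro I[of "w l k" "\<lambda>x. B a (g' + x)" "w k l" "\<lambda>x. B (g' + x) a"]) (auto simp: e)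
    qed
  next
    case False
    with P_cases[OF kl] have sym: "symmetric_map B \<or> alternating_map B" and kl': "(k, l) \<in> P \<or> (l, k) \<in> P"
      by auto
    have neg: "nonconst_affine_map_on H (\<lambda>x. - f x)" if "nonconst_affine_map_on H f" for f :: "'g \<times> 'g \<Rightarrow> 'r mod_ring"
    proof -
      have "affine_map_on H (\<lambda>x. f x * (-1))"
        using that by (intro affine_map_on_mult_right) (simp add: nonconst_affine_map_on_def)
      moreover have "\<not> (\<lambda>x. - f x) constant_on H"
      proof
        assume "(\<lambda>x. - f x) constant_on H"
        then obtain c where "\<And>x. x \<in> H \<Longrightarrow> - f x = c" unfolding constant_on_def by blast
        then have "\<And>x. x \<in> H \<Longrightarrow> f x = - c" by fastforce
        then show False using that unfolding nonconst_affine_map_on_def constant_on_def by blast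
      qed
      ultimately show ?thesis by (simp add: nonconst_affine_map_on_def)
    qed
    have both: "nonconst_affine_map_on H (\<lambda>x. B (g' + x) a)" "nonconst_affine_map_on H (\<lambda>x. B a (g' + x))"
    proof -
      have "(\<lambda>x. B (g' + x) a) = (\<lambda>x. B a (g' + x))" if "symmetric_map B"
        using that unfolding symmetric_map_def by blast
      moreover have "(\<lambda>x. B (g' + x) a) = (\<lambda>x. - B a (g' + x))" "(\<lambda>x. B a (g' + x)) = (\<lambda>x. - B (g' + x) a)"
        if "alternating_map B"
        using that unfolding alternating_map_def by blast+
      ultimately show "nonconst_affine_map_on H (\<lambda>x. B (g' + x) a)" "nonconst_affine_map_on H (\<lambda>x. B a (g' + x))"
        using sym aff neg by metis+
    qed
    show ?thesis
    proof (cases "(k, l) \<in> P")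
      case True
      with False have "edge k l x a * edge l k a x = char_fun (w k l) (B x a) * char_fun (w k l) 0" for x
        using w_P[OF True] by (simp add: edge_def)
      then show ?thesis
        using both True w_P
        by (intro I[of "w k l" "\<lambda>x. B (g' + x) a" "w k l" "\<lambda>x. 0"]) (auto)
    next
      case F: False
      with kl' have T: "(l, k) \<in> P" by simp
      with F have "edge k l x a * edge l k a x = char_fun (w l k) (B a x) * char_fun (w l k) 0" for x
        using w_P[OF T] by (simp add: edge_def)
      then show ?thesis
        using both T w_P
        by (intro I[of "w l k" "\<lambda>x. B a (g' + x)" "w l k" "\<lambda>x. 0"]) (auto)
    qed
  qed
qed

lemma isotropic_card_le:
  assumes "isotropic B W"
  shows "card W \<le> CARD('g)"
proof -
  have "finite {card W |W. isotropic B W}" by (rule finite_subset[of _ "range card"]) auto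
  then have "card W \<le> Max {card W |W. isotropic B W}" using assms by (intro Max_ge) auto
  then show ?thesis using cond_i by (simp add: condition_i_def)
qed

text \<open>Parametrise \<open>W\<close> by \<open>H\<close>. Each index in \<open>D\<close>
  contributes one affine nonconstant factor, and these give the bound; the companion factors and the
  vertex factor are then added as arbitrary phases without changing it.\<close>

lemma norm_column_sum_le:
  assumes \<eta>: "0 \<le> \<eta>" "\<eta> \<le> 1/2"
    and \<rho>: "\<And>H (F :: 'g \<times> 'g \<Rightarrow> 'r mod_ring). \<not> F constant_on H \<Longrightarrow>
      cmod (\<Sum>h\<in>H. zeta_pow (F h)) \<le> \<rho> * real (card H)"
    and W: "isotropic B W" "card W = CARD('g)"
    and D: "D \<subseteq> {1..n}" "k \<in> {1..n} - D" "\<And>l. l \<in> D \<Longrightarrow> a l \<notin> W"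
  shows "cmod (\<Sum>x\<in>W. vertex k x * (\<Prod>l\<in>D. edge k l x (a l) * edge l k (a l) x)) \<le>
     real CARD('g) * max \<rho> (1 - min \<eta> (real (card D) * (\<alpha> * (1 - 2 * \<eta>))))"
proof -
  obtain H g' where H: "is_subgroup H" "W = (+) g' ` H"
    and aff: "\<And>g. g \<notin> W \<Longrightarrow> nonconst_affine_map_on H (\<lambda>x. B (g' + x) g) \<or> nonconst_affine_map_on H (\<lambda>x. B g (g' + x))"
    using cond_ii W unfolding condition_ii_def by blast
  have inj: "inj_on ((+) g') H" by simp
  have cardH: "card H = CARD('g)" using W(2) H(2) card_image[OF inj] by simp
  have fin: "finite D" using D(1) finite_subset by blast
  have "\<forall>l. \<exists>(w1 :: 'r mod_ring \<Rightarrow> real) v1 (w2 :: 'r mod_ring \<Rightarrow> real) v2. l \<in> D \<longrightarrow>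
      balanced_weights p \<alpha> w1 \<and> nonconst_affine_map_on H v1 \<and> balanced_weights p \<alpha> w2 \<and>
      (\<forall>h. edge k l (g' + h) (a l) * edge l k (a l) (g' + h) = char_fun w1 (v1 h) * char_fun w2 (v2 h))"
  proof
    fix l
    show "\<exists>(w1 :: 'r mod_ring \<Rightarrow> real) v1 (w2 :: 'r mod_ring \<Rightarrow> real) v2. l \<in> D \<longrightarrow>
      balanced_weights p \<alpha> w1 \<and> nonconst_affine_map_on H v1 \<and> balanced_weights p \<alpha> w2 \<and>
      (\<forall>h. edge k l (g' + h) (a l) * edge l k (a l) (g' + h) = char_fun w1 (v1 h) * char_fun w2 (v2 h))"
    proof (cases "l \<in> D")
      case True
      then have "l \<in> {1..n}" "k \<noteq> l" "k \<in> {1..n}" using D by auto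
      from edge_pair_factors[OF this(3,1,2) aff[OF D(3)[OF True]]] show ?thesis by blast
    qed simp
  qed
  then obtain w1 w2 :: "nat \<Rightarrow> 'r mod_ring \<Rightarrow> real" and v1 v2 where
    f: "\<And>l. l \<in> D \<Longrightarrow> balanced_weights p \<alpha> (w1 l)" "\<And>l. l \<in> D \<Longrightarrow> nonconst_affine_map_on H (v1 l)"
      "\<And>l. l \<in> D \<Longrightarrow> balanced_weights p \<alpha> (w2 l)"
      "\<And>l h. l \<in> D \<Longrightarrow> edge k l (g' + h) (a l) * edge l k (a l) (g' + h) = char_fun (w1 l) (v1 l h) * char_fun (w2 l) (v2 l h)"
    by metis
  let ?b = "real (card H) * max \<rho> (1 - min \<eta> (real (card D) * (\<alpha> * (1 - 2 * \<eta>))))"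
  have b1: "cmod (\<Sum>h\<in>H. zeta_pow (F h) * (\<Prod>l\<in>D. char_fun (w1 l) (v1 l h))) \<le> ?b" for F :: "'g \<times> 'g \<Rightarrow> 'r mod_ring"
    by (rule norm_sum_affine_product_le[OF p \<alpha> \<eta> fin f(1,2) H(1) \<rho>])
  have b2: "cmod (\<Sum>h\<in>H. zeta_pow (F h) * ((\<Prod>l\<in>D. char_fun (w2 l) (v2 l h)) * (\<Prod>l\<in>D. char_fun (w1 l) (v1 l h)))) \<le> ?b"
    for F :: "'g \<times> 'g \<Rightarrow> 'r mod_ring"
    by (rule norm_sum_char_fun_mult_le[OF fin f(3) b1])
  \<comment> \<open>The product over the singleton \<open>{k}\<close> brings the single vertex
    factor into the shape required for absorption.\<close>
  have b3: "cmod (\<Sum>h\<in>H. zeta_pow (0::'r mod_ring) * ((\<Prod>j\<in>{k}. char_fun (w j j) (U (g' + h))) *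
      ((\<Prod>l\<in>D. char_fun (w2 l) (v2 l h)) * (\<Prod>l\<in>D. char_fun (w1 l) (v1 l h))))) \<le> ?b"
    by (rule norm_sum_char_fun_mult_le[where F = "\<lambda>_. 0" and v = "\<lambda>_ h. U (g' + h)" and w = "\<lambda>j. w j j", OF _ _ b2])
       (use D w_diag in auto)
  have "(\<Sum>x\<in>W. vertex k x * (\<Prod>l\<in>D. edge k l x (a l) * edge l k (a l) x)) =
     (\<Sum>h\<in>H. vertex k (g' + h) * (\<Prod>l\<in>D. edge k l (g' + h) (a l) * edge l k (a l) (g' + h)))"
    unfolding H(2) by (subst sum.reindex[OF inj]) simp
  also have "\<dots> = (\<Sum>h\<in>H. zeta_pow (0::'r mod_ring) * ((\<Prod>j\<in>{k}. char_fun (w j j) (U (g' + h))) *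
      ((\<Prod>l\<in>D. char_fun (w2 l) (v2 l h)) * (\<Prod>l\<in>D. char_fun (w1 l) (v1 l h)))))"
    using f(4) by (intro sum.cong refl) (simp add: vertex_def prod.distrib mult_ac cong: prod.cong)
  finally show ?thesis using b3 cardH by simp
qed

text \<open>Edges between two indices outside \<open>D\<close> are 1 by isotropy, so every remaining
  factor depends on at most one of the \<open>b k\<close>. This is what lets the sum over
  \<open>b\<close> factorise.\<close>

lemma summand_split:
  assumes D: "D \<subseteq> {1..n}" and W: "isotropic B W" and b: "\<And>k. k \<in> {1..n} - D \<Longrightarrow> b k \<in> W"
  shows "summand (\<lambda>k. if k \<in> D then a k else b k) =
    ((\<Prod>k\<in>D. vertex k (a k)) * (\<Prod>k\<in>D. \<Prod>l\<in>D. edge k l (a k) (a l))) *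
    (\<Prod>k\<in>{1..n} - D. vertex k (b k) * (\<Prod>l\<in>D. edge k l (b k) (a l) * edge l k (a l) (b k)))"
proof -
  let ?K = "{1..n} - D"
  let ?m = "\<lambda>k. if k \<in> D then a k else b k"
  have sp: "(\<Prod>k\<in>{1..n}. f k) = (\<Prod>k\<in>?K. f k) * (\<Prod>k\<in>D. f k)" for f :: "nat \<Rightarrow> complex"
    by (rule prod.subset_diff) (use D in auto)
  have one: "edge k l (b k) (b l) = 1" if "k \<in> ?K" "l \<in> ?K" for k l
  proof -
    have "B (b k) (b l) = 0" using W b[OF that(1)] b[OF that(2)] by (auto simp: isotropic_def)
    then show ?thesis using char_fun_0[OF w_P] by (simp add: edge_def)
  qed
  have "(\<Prod>k\<in>{1..n}. \<Prod>l\<in>{1..n}. edge k l (?m k) (?m l)) =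
    (\<Prod>k\<in>?K. (\<Prod>l\<in>?K. edge k l (?m k) (?m l)) * (\<Prod>l\<in>D. edge k l (?m k) (?m l))) *
    (\<Prod>k\<in>D. (\<Prod>l\<in>?K. edge k l (?m k) (?m l)) * (\<Prod>l\<in>D. edge k l (?m k) (?m l)))"
    unfolding sp ..
  also have "\<dots> = (\<Prod>k\<in>?K. \<Prod>l\<in>?K. edge k l (?m k) (?m l)) * (\<Prod>k\<in>?K. \<Prod>l\<in>D. edge k l (?m k) (?m l)) *
    ((\<Prod>k\<in>D. \<Prod>l\<in>?K. edge k l (?m k) (?m l)) * (\<Prod>k\<in>D. \<Prod>l\<in>D. edge k l (?m k) (?m l)))"
    unfolding prod.distrib ..
  also have "(\<Prod>k\<in>?K. \<Prod>l\<in>?K. edge k l (?m k) (?m l)) = 1"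
    by (intro prod.neutral ballI) (simp add: one)
  also have "(\<Prod>k\<in>?K. \<Prod>l\<in>D. edge k l (?m k) (?m l)) = (\<Prod>k\<in>?K. \<Prod>l\<in>D. edge k l (b k) (a l))"
    by (intro prod.cong refl) simp
  also have "(\<Prod>k\<in>D. \<Prod>l\<in>?K. edge k l (?m k) (?m l)) = (\<Prod>k\<in>D. \<Prod>l\<in>?K. edge k l (a k) (b l))"
    by (intro prod.cong refl) simp
  also have "(\<Prod>k\<in>D. \<Prod>l\<in>D. edge k l (?m k) (?m l)) = (\<Prod>k\<in>D. \<Prod>l\<in>D. edge k l (a k) (a l))"
    by (intro prod.cong refl) simp
  also have "(\<Prod>k\<in>D. \<Prod>l\<in>?K. edge k l (a k) (b l)) = (\<Prod>k\<in>?K. \<Prod>l\<in>D. edge l k (a l) (b k))"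
    by (rule prod.swap)
  finally have e: "(\<Prod>k\<in>{1..n}. \<Prod>l\<in>{1..n}. edge k l (?m k) (?m l)) = 1 * (\<Prod>k\<in>?K. \<Prod>l\<in>D. edge k l (b k) (a l)) *
     ((\<Prod>k\<in>?K. \<Prod>l\<in>D. edge l k (a l) (b k)) * (\<Prod>k\<in>D. \<Prod>l\<in>D. edge k l (a k) (a l)))" .
  have v: "(\<Prod>k\<in>{1..n}. vertex k (?m k)) = (\<Prod>k\<in>?K. vertex k (b k)) * (\<Prod>k\<in>D. vertex k (a k))"
    unfolding sp by (intro arg_cong2[where f = times] prod.cong refl) auto
  show ?thesis unfolding summand_def e v by (simp add: prod.distrib mult_ac)
qed

text \<open>For fixed entries on \<open>D\<close>, the sum over the other entries is a product of
  \<open>n - card D\<close> column sums, times a constant of modulus at most 1. The entries on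
  \<open>D\<close> themselves are merely counted.\<close>

lemma norm_fibre_sum_le:
  assumes \<eta>: "0 \<le> \<eta>" "\<eta> \<le> 1/2" and \<rho>0: "0 \<le> \<rho>"
    and \<rho>: "\<And>H (F :: 'g \<times> 'g \<Rightarrow> 'r mod_ring). \<not> F constant_on H \<Longrightarrow>
      cmod (\<Sum>h\<in>H. zeta_pow (F h)) \<le> \<rho> * real (card H)"
    and W: "isotropic B W" "card W = CARD('g)"
    and D: "D \<subseteq> {1..n}"
  shows "cmod (\<Sum>g\<in>PiE {1..n} (\<lambda>k. if k \<in> D then - W else W). summand g) \<le>
    (real CARD('g))\<^sup>2 ^ card D *
    (real CARD('g) * max \<rho> (1 - min \<eta> (real (card D) * (\<alpha> * (1 - 2 * \<eta>))))) ^ (n - card D)"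
proof -
  let ?K = "{1..n} - D"
  let ?b = "real CARD('g) * max \<rho> (1 - min \<eta> (real (card D) * (\<alpha> * (1 - 2 * \<eta>))))"
  have fin: "finite D" using D finite_subset by blast
  have cardK: "card ?K = n - card D" using D fin by (simp add: card_Diff_subset)
  have inner: "cmod (\<Sum>b\<in>PiE ?K (\<lambda>_. W). summand (\<lambda>k. if k \<in> D then a k else b k)) \<le> ?b ^ (n - card D)"
    if a: "a \<in> PiE D (\<lambda>_. - W)" for a
  proof -
    let ?c = "(\<Prod>k\<in>D. vertex k (a k)) * (\<Prod>k\<in>D. \<Prod>l\<in>D. edge k l (a k) (a l))"
    let ?f = "\<lambda>k x. vertex k x * (\<Prod>l\<in>D. edge k l x (a l) * edge l k (a l) x)"
    have "(\<Sum>b\<in>PiE ?K (\<lambda>_. W). summand (\<lambda>k. if k \<in> D then a k else b k)) =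
      (\<Sum>b\<in>PiE ?K (\<lambda>_. W). ?c * (\<Prod>k\<in>?K. ?f k (b k)))"
      by (intro sum.cong refl summand_split[OF D W(1)]) (auto simp: PiE_def Pi_def)
    also have "\<dots> = ?c * (\<Prod>k\<in>?K. \<Sum>x\<in>W. ?f k x)"
      unfolding sum_distrib_left[symmetric] by (subst prod_sum_PiE) auto
    finally have eq: "(\<Sum>b\<in>PiE ?K (\<lambda>_. W). summand (\<lambda>k. if k \<in> D then a k else b k)) =
      ?c * (\<Prod>k\<in>?K. \<Sum>x\<in>W. ?f k x)" .
    have "cmod (?c * (\<Prod>k\<in>?K. \<Sum>x\<in>W. ?f k x)) \<le> 1 * (\<Prod>k\<in>?K. ?b)"
      unfolding norm_mult[of ?c]
    proof (rule mult_mono)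
      show "cmod ?c \<le> 1"
        unfolding norm_mult
        using norm_vertices_le_1[of D a] D norm_edges_le_1[where S = D and T = D and g = a and h = a]
        by (intro mult_le_one) auto
      show "cmod (\<Prod>k\<in>?K. \<Sum>x\<in>W. ?f k x) \<le> (\<Prod>k\<in>?K. ?b)"
        unfolding prod_norm[symmetric]
      proof (rule prod_mono, rule conjI)
        fix k assume k: "k \<in> ?K"
        show "cmod (\<Sum>x\<in>W. ?f k x) \<le> ?b"
          by (rule norm_column_sum_le[OF \<eta> \<rho> W D k]) (use a in \<open>auto simp: PiE_def Pi_def\<close>)
      qed auto
    qed auto
    then show ?thesis unfolding eq prod_constant cardK by simp
  qed
  have "cmod (\<Sum>g\<in>PiE {1..n} (\<lambda>k. if k \<in> D then - W else W). summand g) \<le>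
     (\<Sum>a\<in>PiE D (\<lambda>_. - W). ?b ^ (n - card D))"
    unfolding sum_PiE_split[OF D] by (rule order_trans[OF norm_sum sum_mono[OF inner]])
  also have "\<dots> = real (card (- W)) ^ card D * ?b ^ (n - card D)"
    using fin by (simp add: card_PiE)
  also have "\<dots> \<le> (real CARD('g))\<^sup>2 ^ card D * ?b ^ (n - card D)"
  proof (intro mult_right_mono power_mono)
    have "card (- W) \<le> CARD('g \<times> 'g)" by (intro card_mono) auto
    then have "real (card (- W)) \<le> real (CARD('g) * CARD('g))"
      unfolding of_nat_le_iff by (simp add: card_prod)
    then show "real (card (- W)) \<le> (real CARD('g))\<^sup>2" by (simp add: power2_eq_square)
    have "0 \<le> ?b" using \<rho>0 by (intro mult_nonneg_nonneg) (auto simp: le_max_iff_disj)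
    then show "0 \<le> ?b ^ (n - card D)" by simp
  qed auto
  finally show ?thesis .
qed

text \<open>Here the entries all lie in \<open>W\<close>, so edges give nothing, and the saving
  comes from the vertices. Dropping the edges makes the sum factorise, and each coordinate loses
  \<open>\<kappa> * \<alpha> / 2\<close> at the value \<open>u\<close>.\<close>

lemma sum_norm_isotropic_le:
  assumes \<kappa>: "0 < \<kappa>" "\<And>t::'r mod_ring. t \<noteq> 0 \<Longrightarrow> Re (zeta_pow t) \<le> 1 - \<kappa>"
    and W: "card W = CARD('g)" and u: "u \<in> W" "U u \<noteq> 0"
  shows "(\<Sum>g\<in>PiE {1..n} (\<lambda>_. W). cmod (summand g)) \<le> (real CARD('g) - \<kappa> * \<alpha> / 2) ^ n"
proof -
  have "(\<Sum>g\<in>PiE {1..n} (\<lambda>_. W). cmod (summand g)) \<le> (\<Sum>g\<in>PiE {1..n} (\<lambda>_. W). \<Prod>k\<in>{1..n}. cmod (vertex k (g k)))"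
  proof (rule sum_mono)
    fix g
    show "cmod (summand g) \<le> (\<Prod>k\<in>{1..n}. cmod (vertex k (g k)))"
      unfolding summand_def norm_mult prod_norm
      using norm_edges_le_1[where S = "{1..n}" and T = "{1..n}" and g = g and h = g]
      by (intro mult_right_le_one_le) auto
  qed
  also have "\<dots> = (\<Prod>k\<in>{1..n}. \<Sum>x\<in>W. cmod (vertex k x))"
    by (subst prod_sum_PiE) auto
  also have "\<dots> \<le> (\<Prod>k\<in>{1..n}. real CARD('g) - \<kappa> * \<alpha> / 2)"
  proof (rule prod_mono, rule conjI)
    fix k assume k: "k \<in> {1..n}"
    have "(\<Sum>x\<in>W. cmod (vertex k x)) = (\<Sum>x\<in>W - {u}. cmod (vertex k x)) + cmod (vertex k u)"
      using u by (simp add: sum.remove add.commute)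
    moreover have "(\<Sum>x\<in>W - {u}. cmod (vertex k x)) \<le> (\<Sum>x\<in>W - {u}. 1)"
      using norm_vertex_le_1[OF k] by (intro sum_mono)
    moreover have "(\<Sum>x\<in>W - {u}. 1) = real CARD('g) - 1"
    proof -
      have "card W = Suc (card (W - {u}))" using card_Suc_Diff1[OF finite u(1)] by (rule sym)
      then show ?thesis using W by simp
    qed
    moreover have "cmod (vertex k u) \<le> 1 - \<kappa> * \<alpha> / 2"
      unfolding vertex_def by (rule norm_char_fun_le[OF p w_diag[OF k] u(2) \<kappa>])
    ultimately show "(\<Sum>x\<in>W. cmod (vertex k x)) \<le> real CARD('g) - \<kappa> * \<alpha> / 2" by linarith
  qed (auto intro: sum_nonneg)
  finally show ?thesis by simp
qed

subsection \<open>Decomposition of the set of tuples\<close>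

definition tuples :: "(nat \<Rightarrow> 'g \<times> 'g) set" where
  "tuples = {1..n} \<rightarrow>\<^sub>E UNIV"

definition outside :: "(nat \<Rightarrow> 'g \<times> 'g) \<Rightarrow> ('g \<times> 'g) set \<Rightarrow> nat set" where
  "outside g T = {k\<in>{1..n}. g k \<notin> T}"

definition near :: "real \<Rightarrow> ('g \<times> 'g) set \<Rightarrow> (nat \<Rightarrow> 'g \<times> 'g) set" where
  "near \<epsilon> T = {g\<in>tuples. real (card (outside g T)) \<le> \<epsilon> * real n}"

text \<open>These tuples are only counted, each with a summand of modulus at most 1. Overlaps of two
  \<open>near\<close> sets, and trivial tuples that leave \<open>W\<close>, also end up
  here.\<close>

definition degenerate :: "real \<Rightarrow> (nat \<Rightarrow> 'g \<times> 'g) set" where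
  "degenerate \<epsilon> = (\<Union>T\<in>{T. card T < CARD('g)}. near \<epsilon> T)"

definition spread :: "real \<Rightarrow> (nat \<Rightarrow> 'g \<times> 'g) set" where
  "spread \<epsilon> = {g\<in>tuples. \<exists>v v'. B v v' \<noteq> 0 \<and> \<epsilon> * real n \<le> real (card {k\<in>{1..n}. g k = v}) \<and>
     \<epsilon> * real n \<le> real (card {k\<in>{1..n}. g k = v'})}"

definition max_isotropic :: "('g \<times> 'g) set set" where
  "max_isotropic = {W. isotropic B W \<and> card W = CARD('g)}"

lemma finite_tuples [simp]: "finite tuples"
  unfolding tuples_def by (intro finite_PiE) auto

lemma finite_near [simp]: "finite (near \<epsilon> T)"
  by (rule finite_subset[OF _ finite_tuples]) (auto simp: near_def)

lemma finite_degenerate [simp]: "finite (degenerate \<epsilon>)"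
  unfolding degenerate_def by simp

lemma card_tuples: "real (card tuples) = (real CARD('g))\<^sup>2 ^ n"
  unfolding tuples_def by (simp add: card_PiE card_prod power2_eq_square power_mult_distrib)

lemma finite_outside [simp]: "finite (outside g T)"
  by (simp add: outside_def)

lemma outside_fibre: "{g\<in>tuples. outside g T = D} = PiE {1..n} (\<lambda>k. if k \<in> D then - T else T)"
  if "D \<subseteq> {1..n}"
proof (intro equalityI subsetI)
  fix g assume "g \<in> {g\<in>tuples. outside g T = D}"
  then show "g \<in> PiE {1..n} (\<lambda>k. if k \<in> D then - T else T)"
    by (auto simp: tuples_def outside_def PiE_def Pi_def)
next
  fix g assume g: "g \<in> PiE {1..n} (\<lambda>k. if k \<in> D then - T else T)"
  have "g k \<notin> T \<longleftrightarrow> k \<in> D" if "k \<in> {1..n}" for k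
    using PiE_mem[OF g that] by (auto split: if_splits)
  then have "outside g T = {k\<in>{1..n}. k \<in> D}" unfolding outside_def by blast
  then have "outside g T = D" using \<open>D \<subseteq> {1..n}\<close> by blast
  then show "g \<in> {g\<in>tuples. outside g T = D}" using g by (auto simp: tuples_def PiE_def)
qed

text \<open>Let \<open>T\<close> consist of the frequent values of the tuple. Each rare value occurs
  on fewer than \<open>\<epsilon> * n / N^2\<close> indices, where \<open>N = CARD('g)\<close>, and
  there are at most \<open>N^2\<close> of them, so the tuple is near \<open>T\<close>. The three
  sets correspond to \<open>T\<close> not isotropic, isotropic and too small, or isotropic of
  maximal size.\<close>

lemma tuples_cover:
  assumes "0 \<le> \<epsilon>"
  shows "tuples \<subseteq> spread (\<epsilon> / (real CARD('g))\<^sup>2) \<union> degenerate \<epsilon> \<union> (\<Union>W\<in>max_isotropic. near \<epsilon> W)"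
proof
  fix g assume g: "g \<in> tuples"
  let ?e = "\<epsilon> / (real CARD('g))\<^sup>2"
  define T where "T = {v. ?e * real n \<le> real (card {k\<in>{1..n}. g k = v})}"
  have "outside g T \<subseteq> (\<Union>v\<in>- T. {k\<in>{1..n}. g k = v})"
    by (auto simp: outside_def)
  then have "card (outside g T) \<le> card (\<Union>v\<in>- T. {k\<in>{1..n}. g k = v})"
    by (intro card_mono) auto
  also have "\<dots> \<le> (\<Sum>v\<in>- T. card {k\<in>{1..n}. g k = v})" by (rule card_UN_le) simp
  finally have "real (card (outside g T)) \<le> (\<Sum>v\<in>- T. real (card {k\<in>{1..n}. g k = v}))"
    unfolding of_nat_sum[symmetric] of_nat_le_iff .
  also have "\<dots> \<le> (\<Sum>v\<in>- T. ?e * real n)"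
    by (intro sum_mono) (auto simp: T_def)
  also have "\<dots> \<le> (\<Sum>v\<in>(UNIV :: ('g \<times> 'g) set). ?e * real n)"
    using assms by (intro sum_mono2) auto
  also have "\<dots> = \<epsilon> * real n"
    by (simp add: card_prod power2_eq_square)
  finally have near: "g \<in> near \<epsilon> T" using g by (simp add: near_def)
  show "g \<in> spread ?e \<union> degenerate \<epsilon> \<union> (\<Union>W\<in>max_isotropic. near \<epsilon> W)"
  proof (cases "isotropic B T")
    case False
    then obtain v v' where "v \<in> T" "v' \<in> T" "B v v' \<noteq> 0" unfolding isotropic_def by blast
    then have "g \<in> spread ?e" using g unfolding spread_def T_def by blast
    then show ?thesis by blast
  next
    case True
    show ?thesis
    proof (cases "card T < CARD('g)")
      case False
      with isotropic_card_le[OF True] True have "T \<in> max_isotropic" by (simp add: max_isotropic_def)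
      then show ?thesis using near by blast
    qed (use near in \<open>auto simp: degenerate_def\<close>)
  qed
qed

text \<open>Distinct sets of equal size meet in fewer elements, and the exceptional indices for the
  two sets add up; hence the doubled radius.\<close>

lemma near_disjoint:
  assumes W: "W \<in> max_isotropic" "W' \<in> max_isotropic" "W \<noteq> W'" and g: "g \<in> near \<epsilon> W" "g \<in> near \<epsilon> W'"
  shows "g \<in> degenerate (2 * \<epsilon>)"
proof -
  have "W \<inter> W' \<subset> W"
  proof (rule ccontr)
    assume "\<not> W \<inter> W' \<subset> W"
    then have "W \<subseteq> W'" by blast
    then have "W = W'" using W by (intro card_subset_eq) (auto simp: max_isotropic_def)
    with W show False by simp
  qed
  then have "card (W \<inter> W') < card W" by (intro psubset_card_mono) auto
  then have "card (W \<inter> W') < CARD('g)" using W by (simp add: max_isotropic_def)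
  moreover have "g \<in> near (2 * \<epsilon>) (W \<inter> W')"
  proof -
    have "outside g (W \<inter> W') = outside g W \<union> outside g W'" by (auto simp: outside_def)
    then have "card (outside g (W \<inter> W')) \<le> card (outside g W) + card (outside g W')"
      by (simp add: card_Un_le)
    then have "real (card (outside g (W \<inter> W'))) \<le> real (card (outside g W)) + real (card (outside g W'))"
      by linarith
    then show ?thesis using g by (simp add: near_def)
  qed
  ultimately show ?thesis by (auto simp: degenerate_def)
qed

text \<open>The values of a trivial tuple form an isotropic set. If they exhausted \<open>W\<close>,
  the stray entry together with \<open>W\<close> would be isotropic with more than
  \<open>CARD('g)\<close> elements. So the tuple is near the smaller set of those elements of
  \<open>W\<close> that it attains.\<close>

lemma near_G_tr_degenerate:
  assumes W: "W \<in> max_isotropic" and g: "g \<in> near \<epsilon> W" "g \<in> G_tr U B n" "outside g W \<noteq> {}" and \<epsilon>: "0 \<le> \<epsilon>"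
  shows "g \<in> degenerate (2 * \<epsilon>)"
proof -
  obtain k where k: "k \<in> {1..n}" "g k \<notin> W" using g(3) by (auto simp: outside_def)
  have iso: "isotropic B (g ` {1..n})" using g(2) by (auto simp: G_tr_def isotropic_def)
  have "W \<inter> g ` {1..n} \<subset> W"
  proof (rule ccontr)
    assume "\<not> W \<inter> g ` {1..n} \<subset> W"
    then have "insert (g k) W \<subseteq> g ` {1..n}" using k by blast
    then have "isotropic B (insert (g k) W)" using iso unfolding isotropic_def by blast
    then have "card (insert (g k) W) \<le> CARD('g)" by (rule isotropic_card_le)
    then show False using W k by (simp add: max_isotropic_def)
  qed
  then have "card (W \<inter> g ` {1..n}) < card W" by (intro psubset_card_mono) auto
  then have "card (W \<inter> g ` {1..n}) < CARD('g)" using W by (simp add: max_isotropic_def)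
  moreover have "outside g (W \<inter> g ` {1..n}) = outside g W" by (auto simp: outside_def)
  moreover have "\<epsilon> * real n \<le> 2 * \<epsilon> * real n" using \<epsilon> by (intro mult_right_mono) auto
  ultimately show ?thesis using g(1) by (force simp: degenerate_def near_def)
qed

text \<open>For each \<open>T\<close>, classify the nearby tuples by their exceptional indices
  \<open>D\<close>: at most \<open>CARD('g) - 1\<close> choices remain at every other index. Summing
  over all subsets of the square group costs only a constant factor.\<close>

lemma card_degenerate_le:
  "real (card (degenerate \<delta>)) \<le> real CARD(('g \<times> 'g) set) *
     (\<Sum>D | D \<subseteq> {1..n} \<and> real (card D) \<le> \<delta> * real n.
        (real CARD('g))\<^sup>2 ^ card D * (real CARD('g) - 1) ^ (n - card D))"
proof -
  let ?DD = "{D. D \<subseteq> {1..n} \<and> real (card D) \<le> \<delta> * real n}"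
  let ?s = "\<Sum>D\<in>?DD. (real CARD('g))\<^sup>2 ^ card D * (real CARD('g) - 1) ^ (n - card D)"
  have N: "real CARD('g) \<ge> 1" by (simp add: Suc_le_eq)
  have s0: "0 \<le> ?s" using N by (intro sum_nonneg) auto
  have finD: "finite ?DD" by (rule finite_subset[of _ "Pow {1..n}"]) auto
  have 1: "real (card (near \<delta> T)) \<le> ?s" if T: "card T < CARD('g)" for T
  proof -
    have "near \<delta> T = (\<Union>D\<in>?DD. {g\<in>tuples. outside g T = D})"
      by (auto simp: near_def outside_def)
    then have "card (near \<delta> T) \<le> (\<Sum>D\<in>?DD. card {g\<in>tuples. outside g T = D})"
      using card_UN_le[OF finD] by simp
    then have "real (card (near \<delta> T)) \<le> (\<Sum>D\<in>?DD. real (card {g\<in>tuples. outside g T = D}))"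
      unfolding of_nat_sum[symmetric] of_nat_le_iff .
    also have "\<dots> \<le> ?s"
    proof (rule sum_mono)
      fix D assume D: "D \<in> ?DD"
      then have D': "D \<subseteq> {1..n}" "finite D" using finite_subset by auto
      have "card {g\<in>tuples. outside g T = D} = (\<Prod>k\<in>{1..n}. card (if k \<in> D then - T else T))"
        unfolding outside_fibre[OF D'(1)] by (rule card_PiE) simp
      also have "\<dots> = (\<Prod>k\<in>{1..n} - D. card (if k \<in> D then - T else T)) * (\<Prod>k\<in>D. card (if k \<in> D then - T else T))"
        by (rule prod.subset_diff) (use D' in auto)
      also have "\<dots> = card T ^ (n - card D) * card (- T) ^ card D"
        using D' by (simp add: card_Diff_subset)
      finally have c: "real (card {g\<in>tuples. outside g T = D}) = real (card (- T)) ^ card D * real (card T) ^ (n - card D)"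
        by simp
      have "card (- T) \<le> CARD('g \<times> 'g)" by (intro card_mono) auto
      then have "real (card (- T)) \<le> real (CARD('g) * CARD('g))"
        unfolding of_nat_le_iff by (simp add: card_prod)
      then have "real (card (- T)) \<le> (real CARD('g))\<^sup>2" by (simp add: power2_eq_square)
      moreover have "real (card T) \<le> real CARD('g) - 1" using T by linarith
      ultimately show "real (card {g\<in>tuples. outside g T = D}) \<le> (real CARD('g))\<^sup>2 ^ card D * (real CARD('g) - 1) ^ (n - card D)"
        unfolding c using N by (intro mult_mono power_mono) auto
    qed
    finally show ?thesis .
  qed
  have "card (degenerate \<delta>) \<le> (\<Sum>T | card T < CARD('g). card (near \<delta> T))"
    unfolding degenerate_def by (rule card_UN_le) simp
  then have "real (card (degenerate \<delta>)) \<le> (\<Sum>T | card T < CARD('g). real (card (near \<delta> T)))"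
    unfolding of_nat_sum[symmetric] of_nat_le_iff .
  also have "\<dots> \<le> (\<Sum>T | card (T :: ('g \<times> 'g) set) < CARD('g). ?s)"
    using 1 by (intro sum_mono) auto
  also have "\<dots> \<le> (\<Sum>T\<in>(UNIV :: ('g \<times> 'g) set set). ?s)"
    using s0 by (intro sum_mono2) auto
  finally show ?thesis by simp
qed

text \<open>Grouping by the set of exceptional indices yields full product sets, to which the fibre
  bound applies. Trivial tuples are kept in the sum on purpose, because removing them would destroy
  the product structure.\<close>

lemma norm_sum_near_outside_le:
  assumes \<eta>: "0 \<le> \<eta>" "\<eta> \<le> 1/2" and \<rho>0: "0 \<le> \<rho>"
    and \<rho>: "\<And>H (F :: 'g \<times> 'g \<Rightarrow> 'r mod_ring). \<not> F constant_on H \<Longrightarrow>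
      cmod (\<Sum>h\<in>H. zeta_pow (F h)) \<le> \<rho> * real (card H)"
    and W: "W \<in> max_isotropic"
  shows "cmod (\<Sum>g | g \<in> near \<epsilon> W \<and> outside g W \<noteq> {}. summand g) \<le>
    (\<Sum>D | D \<subseteq> {1..n} \<and> D \<noteq> {} \<and> real (card D) \<le> \<epsilon> * real n.
      (real CARD('g))\<^sup>2 ^ card D *
      (real CARD('g) * max \<rho> (1 - min \<eta> (real (card D) * (\<alpha> * (1 - 2 * \<eta>))))) ^ (n - card D))"
proof -
  let ?DD = "{D. D \<subseteq> {1..n} \<and> D \<noteq> {} \<and> real (card D) \<le> \<epsilon> * real n}"
  let ?S = "{g. g \<in> near \<epsilon> W \<and> outside g W \<noteq> {}}"
  have finD: "finite ?DD" by (rule finite_subset[of _ "Pow {1..n}"]) auto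
  have finS: "finite ?S" by (rule finite_subset[OF _ finite_near[of \<epsilon> W]]) auto
  have "(\<Sum>g\<in>?S. summand g) = (\<Sum>D\<in>?DD. \<Sum>g | g \<in> ?S \<and> outside g W = D. summand g)"
    by (rule sum.group[OF finS finD, symmetric]) (auto simp: near_def outside_def)
  also have "\<dots> = (\<Sum>D\<in>?DD. \<Sum>g\<in>PiE {1..n} (\<lambda>k. if k \<in> D then - W else W). summand g)"
  proof (rule sum.cong[OF refl])
    fix D assume D: "D \<in> ?DD"
    then have "{g. g \<in> ?S \<and> outside g W = D} = {g\<in>tuples. outside g W = D}"
      by (auto simp: near_def)
    also have "\<dots> = PiE {1..n} (\<lambda>k. if k \<in> D then - W else W)"
      by (rule outside_fibre) (use D in auto)
    finally show "(\<Sum>g | g \<in> ?S \<and> outside g W = D. summand g) =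
        (\<Sum>g\<in>PiE {1..n} (\<lambda>k. if k \<in> D then - W else W). summand g)"
      by simp
  qed
  finally have eq: "(\<Sum>g\<in>?S. summand g) = (\<Sum>D\<in>?DD. \<Sum>g\<in>PiE {1..n} (\<lambda>k. if k \<in> D then - W else W). summand g)" .
  show ?thesis
    unfolding eq
  proof (rule order_trans[OF norm_sum sum_mono])
    fix D assume "D \<in> ?DD"
    then have D: "D \<subseteq> {1..n}" by simp
    have W': "isotropic B W" "card W = CARD('g)" using W by (auto simp: max_isotropic_def)
    show "cmod (\<Sum>g\<in>PiE {1..n} (\<lambda>k. if k \<in> D then - W else W). summand g) \<le> (real CARD('g))\<^sup>2 ^ card D *
      (real CARD('g) * max \<rho> (1 - min \<eta> (real (card D) * (\<alpha> * (1 - 2 * \<eta>))))) ^ (n - card D)"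
      by (rule norm_fibre_sum_le[OF \<eta> \<rho>0 \<rho> W' D])
  qed
qed

lemma norm_sum_subset_le_card:
  assumes "finite S"
  shows "cmod (\<Sum>g\<in>S. summand g) \<le> real (card S)"
  using norm_sum[of summand S] sum_mono[of S "\<lambda>g. cmod (summand g)" "\<lambda>_. 1"] norm_summand_le_1 by fastforce

text \<open>The three terms come from the product sets with an exceptional index, from the trivial
  tuples wrongly included there, which are degenerate, and from the nontrivial tuples lying entirely
  in \<open>W\<close>.\<close>

lemma norm_sum_near_nontrivial_le:
  assumes \<epsilon>: "0 \<le> \<epsilon>" and \<eta>: "0 \<le> \<eta>" "\<eta> \<le> 1/2" and \<rho>0: "0 \<le> \<rho>"
    and \<rho>: "\<And>H (F :: 'g \<times> 'g \<Rightarrow> 'r mod_ring). \<not> F constant_on H \<Longrightarrow>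
      cmod (\<Sum>h\<in>H. zeta_pow (F h)) \<le> \<rho> * real (card H)"
    and \<kappa>: "0 < \<kappa>" "\<kappa> \<le> 1" "\<And>t::'r mod_ring. t \<noteq> 0 \<Longrightarrow> Re (zeta_pow t) \<le> 1 - \<kappa>"
    and W: "W \<in> max_isotropic"
  shows "cmod (\<Sum>g\<in>near \<epsilon> W - G_tr U B n. summand g) \<le>
    (\<Sum>D | D \<subseteq> {1..n} \<and> D \<noteq> {} \<and> real (card D) \<le> \<epsilon> * real n.
      (real CARD('g))\<^sup>2 ^ card D *
      (real CARD('g) * max \<rho> (1 - min \<eta> (real (card D) * (\<alpha> * (1 - 2 * \<eta>))))) ^ (n - card D)) +
    real (card (degenerate (2 * \<epsilon>))) + (real CARD('g) - \<kappa> * \<alpha> / 2) ^ n"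
proof -
  let ?S = "{g. g \<in> near \<epsilon> W \<and> outside g W \<noteq> {}}"
  let ?V = "{g\<in>near \<epsilon> W. outside g W = {}} - G_tr U B n"
  have finS: "finite ?S" by (rule finite_subset[OF _ finite_near[of \<epsilon> W]]) auto
  have split: "near \<epsilon> W - G_tr U B n = (?S - G_tr U B n) \<union> ?V" by blast
  have "(\<Sum>g\<in>near \<epsilon> W - G_tr U B n. summand g) = (\<Sum>g\<in>?S - G_tr U B n. summand g) + (\<Sum>g\<in>?V. summand g)"
    unfolding split
  proof (rule sum.union_disjoint)
    show "(?S - G_tr U B n) \<inter> ?V = {}" by blast
  qed (use finS in auto)
  moreover have "(\<Sum>g\<in>?S. summand g) = (\<Sum>g\<in>?S - G_tr U B n. summand g) + (\<Sum>g\<in>?S \<inter> G_tr U B n. summand g)"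
    using finS sum.Int_Diff[of ?S summand "G_tr U B n"] by (simp add: add.commute)
  ultimately have eq: "(\<Sum>g\<in>near \<epsilon> W - G_tr U B n. summand g) =
      (\<Sum>g\<in>?S. summand g) - (\<Sum>g\<in>?S \<inter> G_tr U B n. summand g) + (\<Sum>g\<in>?V. summand g)"
    by simp
  have "cmod (\<Sum>g\<in>near \<epsilon> W - G_tr U B n. summand g) \<le>
     cmod (\<Sum>g\<in>?S. summand g) + cmod (\<Sum>g\<in>?S \<inter> G_tr U B n. summand g) + cmod (\<Sum>g\<in>?V. summand g)"
    unfolding eq by (meson add_mono_thms_linordered_semiring(3) norm_triangle_ineq norm_triangle_ineq4 order_trans)
  moreover have "cmod (\<Sum>g\<in>?S. summand g) \<le> (\<Sum>D | D \<subseteq> {1..n} \<and> D \<noteq> {} \<and> real (card D) \<le> \<epsilon> * real n.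
      (real CARD('g))\<^sup>2 ^ card D *
      (real CARD('g) * max \<rho> (1 - min \<eta> (real (card D) * (\<alpha> * (1 - 2 * \<eta>))))) ^ (n - card D))"
    by (rule norm_sum_near_outside_le[OF \<eta> \<rho>0 \<rho> W])
  moreover have "cmod (\<Sum>g\<in>?S \<inter> G_tr U B n. summand g) \<le> real (card (degenerate (2 * \<epsilon>)))"
  proof -
    have "?S \<inter> G_tr U B n \<subseteq> degenerate (2 * \<epsilon>)" using near_G_tr_degenerate[OF W _ _ _ \<epsilon>] by blast
    then have "card (?S \<inter> G_tr U B n) \<le> card (degenerate (2 * \<epsilon>))" by (intro card_mono) auto
    moreover have "cmod (\<Sum>g\<in>?S \<inter> G_tr U B n. summand g) \<le> real (card (?S \<inter> G_tr U B n))"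
      using finS by (intro norm_sum_subset_le_card) auto
    ultimately show ?thesis by linarith
  qed
  moreover have "cmod (\<Sum>g\<in>?V. summand g) \<le> (real CARD('g) - \<kappa> * \<alpha> / 2) ^ n"
  proof (cases "\<exists>u\<in>W. U u \<noteq> 0")
    case True
    then obtain u where u: "u \<in> W" "U u \<noteq> 0" by blast
    have W': "card W = CARD('g)" using W by (simp add: max_isotropic_def)
    have sub: "?V \<subseteq> PiE {1..n} (\<lambda>_. W)"
      by (auto simp: near_def tuples_def outside_def PiE_def Pi_def)
    have "cmod (\<Sum>g\<in>?V. summand g) \<le> (\<Sum>g\<in>?V. cmod (summand g))" by (rule norm_sum)
    also have "\<dots> \<le> (\<Sum>g\<in>PiE {1..n} (\<lambda>_. W). cmod (summand g))"
      using sub by (intro sum_mono2) (auto intro!: finite_PiE)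
    also have "\<dots> \<le> (real CARD('g) - \<kappa> * \<alpha> / 2) ^ n"
      by (rule sum_norm_isotropic_le[OF \<kappa>(1,3) W' u])
    finally show ?thesis .
  next
    case False
    \<comment> \<open>Now \<open>U\<close> vanishes on \<open>W\<close>, so every tuple with all
      entries in \<open>W\<close> is trivial.\<close>
    have "?V = {}"
    proof (rule ccontr)
      assume "?V \<noteq> {}"
      then obtain g where g: "g \<in> near \<epsilon> W" "outside g W = {}" "g \<notin> G_tr U B n" by blast
      then have gW: "\<And>k. k \<in> {1..n} \<Longrightarrow> g k \<in> W" by (auto simp: outside_def)
      have "g \<in> {1..n} \<rightarrow>\<^sub>E UNIV" using g by (simp add: near_def tuples_def)
      moreover have "U (g k) = 0 \<and> B (g k) (g l) = 0" if "k \<in> {1..n}" "l \<in> {1..n}" for k l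
        using gW[OF that(1)] gW[OF that(2)] False W by (auto simp: max_isotropic_def isotropic_def)
      ultimately have "g \<in> G_tr U B n" by (simp add: G_tr_def)
      with g show False by simp
    qed
    moreover have "0 \<le> real CARD('g) - \<kappa> * \<alpha> / 2"
    proof -
      have "real CARD('g) \<ge> 1" by (simp add: Suc_le_eq)
      moreover have "\<kappa> * \<alpha> \<le> 1 * (1/2)" using \<kappa> \<alpha> by (intro mult_mono) auto
      ultimately show ?thesis by linarith
    qed
    ultimately show ?thesis by (simp only: sum.empty norm_zero zero_le_power)
  qed
  ultimately show ?thesis by linarith
qed

section \<open>Assembling the estimate for one \<open>n\<close>\<close>

lemma sum_norm_spread_le:
  assumes \<kappa>: "0 < \<kappa>" "\<And>t::'r mod_ring. t \<noteq> 0 \<Longrightarrow> Re (zeta_pow t) \<le> 1 - \<kappa>"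
    and \<epsilon>: "1 \<le> \<epsilon> * real n"
  shows "(\<Sum>g\<in>spread \<epsilon>. cmod (summand g)) \<le>
    (real CARD('g))\<^sup>2 ^ n * exp (- (\<kappa> * \<alpha> / 4 * (\<epsilon> * real n * (\<epsilon> * real n - 1))))"
proof -
  have le: "cmod (summand g) \<le> exp (- (\<kappa> * \<alpha> / 4 * (\<epsilon> * real n * (\<epsilon> * real n - 1))))" if g: "g \<in> spread \<epsilon>" for g
  proof -
    obtain v v' where v: "B v v' \<noteq> 0" "\<epsilon> * real n \<le> real (card {k\<in>{1..n}. g k = v})"
      "\<epsilon> * real n \<le> real (card {k\<in>{1..n}. g k = v'})" using g by (auto simp: spread_def)
    \<comment> \<open>The hypothesis \<open>1 \<le> \<epsilon> * real n\<close> makes both lower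
      bounds nonnegative, so they may be multiplied.\<close>
    have "\<epsilon> * real n * (\<epsilon> * real n - 1) \<le> real (card {k\<in>{1..n}. g k = v}) * (real (card {k\<in>{1..n}. g k = v'}) - 1)"
      using v \<epsilon> by (intro mult_mono) auto
    from mult_left_mono[OF this, of "\<kappa> * \<alpha> / 4"]
    have "\<kappa> * \<alpha> / 4 * (\<epsilon> * real n * (\<epsilon> * real n - 1)) \<le>
        \<kappa> * \<alpha> / 4 * (real (card {k\<in>{1..n}. g k = v}) * (real (card {k\<in>{1..n}. g k = v'}) - 1))"
      using \<kappa>(1) \<alpha> by auto
    then have "exp (- (\<kappa> * \<alpha> / 4 * (real (card {k\<in>{1..n}. g k = v}) * (real (card {k\<in>{1..n}. g k = v'}) - 1)))) \<le>
      exp (- (\<kappa> * \<alpha> / 4 * (\<epsilon> * real n * (\<epsilon> * real n - 1))))"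
      by simp
    with norm_summand_nonisotropic_le[OF \<kappa> v(1), of g] show ?thesis by (rule order_trans)
  qed
  have "(\<Sum>g\<in>spread \<epsilon>. cmod (summand g)) \<le> (\<Sum>g\<in>spread \<epsilon>. exp (- (\<kappa> * \<alpha> / 4 * (\<epsilon> * real n * (\<epsilon> * real n - 1)))))"
    using le by (rule sum_mono)
  also have "\<dots> \<le> (\<Sum>g\<in>tuples. exp (- (\<kappa> * \<alpha> / 4 * (\<epsilon> * real n * (\<epsilon> * real n - 1)))))"
    by (rule sum_mono2) (auto simp: spread_def)
  finally show ?thesis by (simp add: card_tuples)
qed

text \<open>The bound near each \<open>W\<close> uses cancellation, so the sum must be split exactly
  before norms are taken. Deleting the degenerate tuples makes the sets near different
  \<open>W\<close> disjoint, and the deleted parts are paid for by counting. This adds a second copy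
  of that count for each \<open>W\<close>.\<close>

lemma norm_sum_nontrivial_le:
  assumes \<epsilon>: "0 \<le> \<epsilon>" "1 \<le> \<epsilon> / (real CARD('g))\<^sup>2 * real n"
    and \<eta>: "0 \<le> \<eta>" "\<eta> \<le> 1/2" and \<rho>0: "0 \<le> \<rho>"
    and \<rho>: "\<And>H (F :: 'g \<times> 'g \<Rightarrow> 'r mod_ring). \<not> F constant_on H \<Longrightarrow>
      cmod (\<Sum>h\<in>H. zeta_pow (F h)) \<le> \<rho> * real (card H)"
    and \<kappa>: "0 < \<kappa>" "\<kappa> \<le> 1" "\<And>t::'r mod_ring. t \<noteq> 0 \<Longrightarrow> Re (zeta_pow t) \<le> 1 - \<kappa>"
  shows "cmod (\<Sum>g\<in>tuples - G_tr U B n. summand g) \<le>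
    (real CARD('g))\<^sup>2 ^ n * exp (- (\<kappa> * \<alpha> / 4 * (\<epsilon> / (real CARD('g))\<^sup>2 * real n * (\<epsilon> / (real CARD('g))\<^sup>2 * real n - 1)))) +
    real (card (degenerate (2 * \<epsilon>))) +
    real CARD(('g \<times> 'g) set) * ((\<Sum>D | D \<subseteq> {1..n} \<and> D \<noteq> {} \<and> real (card D) \<le> \<epsilon> * real n.
      (real CARD('g))\<^sup>2 ^ card D *
      (real CARD('g) * max \<rho> (1 - min \<eta> (real (card D) * (\<alpha> * (1 - 2 * \<eta>))))) ^ (n - card D)) +
      2 * real (card (degenerate (2 * \<epsilon>))) + (real CARD('g) - \<kappa> * \<alpha> / 2) ^ n)"
    (is "_ \<le> ?NI + ?E + _ * ?b")
proof -
  let ?G = "G_tr U B n" and ?D = "degenerate (2 * \<epsilon>)"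
  let ?X = "tuples - ?G"
  let ?C = "\<lambda>W. near \<epsilon> W - ?G - ?D"
  let ?Y = "\<Union>W\<in>max_isotropic. ?C W"
  have fin: "finite ?X" "finite ?Y" "finite (?C W)" for W by auto
  have YX: "?Y \<subseteq> ?X" by (auto simp: near_def)
  \<comment> \<open>The covering lemma works with radius \<epsilon>, the deletion with
    \<open>2 * \<epsilon>\<close>.\<close>
  have deg_mono: "degenerate \<epsilon> \<subseteq> ?D"
  proof -
    have "\<epsilon> * real n \<le> 2 * \<epsilon> * real n" using \<epsilon> by (intro mult_right_mono) auto
    then show ?thesis by (fastforce simp: degenerate_def near_def)
  qed
  have rest: "?X - ?Y - ?D \<subseteq> spread (\<epsilon> / (real CARD('g))\<^sup>2)"
    using tuples_cover[OF \<epsilon>(1)] deg_mono by blast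
  have "(\<Sum>g\<in>?X. summand g) = (\<Sum>g\<in>?X - ?Y. summand g) + (\<Sum>g\<in>?Y. summand g)"
    by (rule sum.subset_diff[OF YX fin(1)])
  also have "(\<Sum>g\<in>?X - ?Y. summand g) = (\<Sum>g\<in>(?X - ?Y) \<inter> ?D. summand g) + (\<Sum>g\<in>?X - ?Y - ?D. summand g)"
    by (rule sum.Int_Diff) (use fin in auto)
  also have "(\<Sum>g\<in>?Y. summand g) = (\<Sum>W\<in>max_isotropic. \<Sum>g\<in>?C W. summand g)"
  proof (rule sum.UNION_disjoint)
    show "\<forall>W\<in>max_isotropic. \<forall>W'\<in>max_isotropic. W \<noteq> W' \<longrightarrow> ?C W \<inter> ?C W' = {}"
      using near_disjoint by blast
  qed (use fin in auto)
  finally have eq: "(\<Sum>g\<in>?X. summand g) = (\<Sum>g\<in>(?X - ?Y) \<inter> ?D. summand g) + (\<Sum>g\<in>?X - ?Y - ?D. summand g) +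
      (\<Sum>W\<in>max_isotropic. \<Sum>g\<in>?C W. summand g)" .
  have 1: "cmod (\<Sum>g\<in>(?X - ?Y) \<inter> ?D. summand g) \<le> ?E"
  proof -
    have "cmod (\<Sum>g\<in>(?X - ?Y) \<inter> ?D. summand g) \<le> real (card ((?X - ?Y) \<inter> ?D))"
      by (intro norm_sum_subset_le_card) auto
    moreover have "card ((?X - ?Y) \<inter> ?D) \<le> card ?D" by (intro card_mono) auto
    ultimately show ?thesis by linarith
  qed
  have 2: "cmod (\<Sum>g\<in>?X - ?Y - ?D. summand g) \<le> ?NI"
  proof -
    have "cmod (\<Sum>g\<in>?X - ?Y - ?D. summand g) \<le> (\<Sum>g\<in>?X - ?Y - ?D. cmod (summand g))" by (rule norm_sum)
    also have "\<dots> \<le> (\<Sum>g\<in>spread (\<epsilon> / (real CARD('g))\<^sup>2). cmod (summand g))"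
      using rest by (intro sum_mono2) (auto intro: finite_subset[OF _ finite_tuples] simp: spread_def)
    also have "\<dots> \<le> ?NI" by (rule sum_norm_spread_le[OF \<kappa>(1,3) \<epsilon>(2)])
    finally show ?thesis .
  qed
  have b: "cmod (\<Sum>g\<in>?C W. summand g) \<le> ?b" if W: "W \<in> max_isotropic" for W
  proof -
    have "(\<Sum>g\<in>near \<epsilon> W - ?G. summand g) = (\<Sum>g\<in>(near \<epsilon> W - ?G) \<inter> ?D. summand g) + (\<Sum>g\<in>?C W. summand g)"
      by (rule sum.Int_Diff) auto
    then have "(\<Sum>g\<in>?C W. summand g) = (\<Sum>g\<in>near \<epsilon> W - ?G. summand g) - (\<Sum>g\<in>(near \<epsilon> W - ?G) \<inter> ?D. summand g)"
      by simp
    then have "cmod (\<Sum>g\<in>?C W. summand g) \<le> cmod (\<Sum>g\<in>near \<epsilon> W - ?G. summand g) + cmod (\<Sum>g\<in>(near \<epsilon> W - ?G) \<inter> ?D. summand g)"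
      using norm_triangle_ineq4 by metis
    moreover have "cmod (\<Sum>g\<in>(near \<epsilon> W - ?G) \<inter> ?D. summand g) \<le> real (card ((near \<epsilon> W - ?G) \<inter> ?D))"
      by (intro norm_sum_subset_le_card) auto
    moreover have "card ((near \<epsilon> W - ?G) \<inter> ?D) \<le> card ?D" by (intro card_mono) auto
    moreover note norm_sum_near_nontrivial_le[OF \<epsilon>(1) \<eta> \<rho>0 \<rho> \<kappa> W]
    ultimately show ?thesis by linarith
  qed
  have b0: "0 \<le> ?b" if "max_isotropic \<noteq> {}"
    using that b norm_ge_zero order_trans by blast
  have 3: "cmod (\<Sum>W\<in>max_isotropic. \<Sum>g\<in>?C W. summand g) \<le> real CARD(('g \<times> 'g) set) * ?b"
  proof (cases "max_isotropic = {}")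
    case True
    have "0 \<le> ?b"
    proof -
      have "real CARD('g) \<ge> 1" by (simp add: Suc_le_eq)
      moreover have "\<kappa> * \<alpha> \<le> 1 * (1/2)" using \<kappa> \<alpha> by (intro mult_mono) auto
      ultimately have "0 \<le> real CARD('g) - \<kappa> * \<alpha> / 2" by linarith
      then show ?thesis using \<rho>0 by (intro add_nonneg_nonneg sum_nonneg mult_nonneg_nonneg zero_le_power) (auto simp: le_max_iff_disj)
    qed
    then show ?thesis using True by simp
  next
    case False
    have "cmod (\<Sum>W\<in>max_isotropic. \<Sum>g\<in>?C W. summand g) \<le> (\<Sum>W\<in>max_isotropic. ?b)"
      by (rule order_trans[OF norm_sum sum_mono[OF b]])
    also have "\<dots> = real (card max_isotropic) * ?b" by simp
    also have "\<dots> \<le> real CARD(('g \<times> 'g) set) * ?b"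
      by (intro mult_right_mono b0[OF False] of_nat_mono card_mono) auto
    finally show ?thesis .
  qed
  have "cmod (\<Sum>g\<in>?X. summand g) \<le> cmod (\<Sum>g\<in>(?X - ?Y) \<inter> ?D. summand g) + cmod (\<Sum>g\<in>?X - ?Y - ?D. summand g) +
      cmod (\<Sum>W\<in>max_isotropic. \<Sum>g\<in>?C W. summand g)"
    unfolding eq by (rule order_trans[OF norm_triangle_ineq]) (intro add_mono norm_triangle_ineq order_refl)
  with 1 2 3 show ?thesis by linarith
qed

end

subsection \<open>The limit\<close>

text \<open>With \<open>t\<close> the subtracted term, \<open>(1 - t) ^ n\<close> is at most
  \<open>exp (- n * t)\<close> as soon as \<open>t \<le> 1\<close>. The product \<open>n * t\<close>
  is a constant times log n, so the decay is only a power of \<open>n\<close>.\<close>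

lemma ln_over_n_power_tendsto_0:
  fixes N \<kappa> c :: real
  assumes "1 \<le> N" "0 < \<kappa>" "0 < c"
  shows "(\<lambda>n. (1 - \<kappa> * (c * ln (real n) / real n) / 2 / N) ^ n) \<longlonglongrightarrow> 0"
proof -
  have "(\<lambda>n. exp (- (\<kappa> * c / (2 * N)) * ln (real n))) \<longlonglongrightarrow> 0"
    using assms by real_asymp
  moreover have "\<forall>\<^sub>F n in sequentially. \<bar>\<kappa> * (c * ln (real n) / real n) / 2 / N\<bar> \<le> 1"
  proof -
    have "(\<lambda>n. \<kappa> * (c * ln (real n) / real n) / 2 / N) \<longlonglongrightarrow> 0" using assms by real_asymp
    then have "\<forall>\<^sub>F n in sequentially. dist (\<kappa> * (c * ln (real n) / real n) / 2 / N) 0 < 1"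
      by (rule tendstoD) simp
    then show ?thesis by eventually_elim (simp add: dist_real_def)
  qed
  then have "\<forall>\<^sub>F n in sequentially. norm ((1 - \<kappa> * (c * ln (real n) / real n) / 2 / N) ^ n) \<le> exp (- (\<kappa> * c / (2 * N)) * ln (real n))"
    using eventually_gt_at_top[of 0]
  proof eventually_elim
    case (elim n)
    define t where "t = \<kappa> * (c * ln (real n) / real n) / 2 / N"
    have "\<bar>t\<bar> \<le> 1" using elim(1) unfolding t_def .
    then have "norm (1 - t) \<le> exp (- t)" using exp_ge_add_one_self[of "- t"] by simp
    then have "norm ((1 - t) ^ n) \<le> exp (- t) ^ n"
      unfolding norm_power by (intro power_mono) auto
    also have "\<dots> = exp (- (\<kappa> * c / (2 * N)) * ln (real n))"
      using elim(2) by (simp add: t_def flip: exp_of_nat_mult)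
    finally show ?case unfolding t_def by simp
  qed
  ultimately show ?thesis by (rule Lim_null_comparison[rotated])
qed

text \<open>This removes the cap: either the base is below the fixed number
  \<open>max \<rho> (1 - \<eta>)\<close>, or it equals \<open>1 - \<beta>\<close> and is at most
  \<open>exp (- \<beta>)\<close>. Adding the two bounds lets the resulting subset sums be treated
  separately.\<close>

lemma max_power_le:
  fixes \<rho> \<eta> \<beta> :: real
  assumes "0 \<le> \<rho>" "\<eta> \<le> 1"
  shows "max \<rho> (1 - min \<eta> \<beta>) ^ j \<le> max \<rho> (1 - \<eta>) ^ j + exp (- (\<beta> * real j))"
proof (cases "max \<rho> (1 - min \<eta> \<beta>) \<le> max \<rho> (1 - \<eta>)")
  case True
  then have "max \<rho> (1 - min \<eta> \<beta>) ^ j \<le> max \<rho> (1 - \<eta>) ^ j"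
    using assms by (intro power_mono) (auto simp: le_max_iff_disj)
  then show ?thesis by (simp add: add_increasing2)
next
  case False
  then have eq: "max \<rho> (1 - min \<eta> \<beta>) = 1 - \<beta>" by (auto simp: max_def min_def split: if_splits)
  then have "0 \<le> 1 - \<beta>" using assms by (metis max.coboundedI1)
  then have "max \<rho> (1 - min \<eta> \<beta>) ^ j \<le> exp (- \<beta>) ^ j"
    unfolding eq using exp_ge_add_one_self[of "- \<beta>"] by (intro power_mono) auto
  also have "\<dots> = exp (- (\<beta> * real j))" by (simp flip: exp_of_nat_mult add: mult.commute)
  moreover have "0 \<le> max \<rho> (1 - \<eta>) ^ j" using assms by (simp add: le_max_iff_disj)
  ultimately show ?thesis by linarith
qed

text \<open>With \<open>m = card D\<close>, division by \<open>N ^ n\<close> leaves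
  \<open>N ^ m\<close> choices. In the exponential part
  \<open>n - m \<ge> (1 - \<epsilon>) * n\<close>, and \<open>\<alpha> * n = c * ln n\<close> turns
  the exponential into the \<open>m\<close>-th power of a negative power of
  \<open>n\<close>.\<close>

lemma sum_subsets_le:
  fixes N \<rho> \<eta> \<epsilon> c c\<^sub>1 \<alpha> :: real and n :: nat
  assumes N: "1 \<le> N" and \<rho>: "0 \<le> \<rho>" and \<eta>: "\<eta> \<le> 1" and \<epsilon>: "0 \<le> \<epsilon>" "\<epsilon> \<le> 1" and c: "0 \<le> c" "0 \<le> c\<^sub>1" and n: "n \<ge> 1"
    and \<alpha>: "\<alpha> = c * ln (real n) / real n"
  shows "(\<Sum>D | D \<subseteq> {1..n} \<and> D \<noteq> {} \<and> real (card D) \<le> \<epsilon> * real n.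
      N\<^sup>2 ^ card D * (N * max \<rho> (1 - min \<eta> (real (card D) * (\<alpha> * c\<^sub>1)))) ^ (n - card D)) / N ^ n \<le>
    (\<Sum>D | D \<subseteq> {1..n} \<and> real (card D) \<le> \<epsilon> * real n. N ^ card D * max \<rho> (1 - \<eta>) ^ (n - card D)) +
    (\<Sum>D | D \<subseteq> {1..n} \<and> D \<noteq> {}. (N * real n powr (- (c * c\<^sub>1 * (1 - \<epsilon>)))) ^ card D)"
proof -
  let ?DD = "{D. D \<subseteq> {1..n} \<and> D \<noteq> {} \<and> real (card D) \<le> \<epsilon> * real n}"
  let ?a = "\<lambda>D. N ^ card D * max \<rho> (1 - \<eta>) ^ (n - card D)"
  let ?b = "\<lambda>D. (N * real n powr (- (c * c\<^sub>1 * (1 - \<epsilon>)))) ^ card D"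
  have fin: "finite (Collect Q)" if "\<And>D. Q D \<Longrightarrow> D \<subseteq> {1..n}" for Q
    by (rule finite_subset[of _ "Pow {1..n}"]) (use that in auto)
  have "(\<Sum>D\<in>?DD. N\<^sup>2 ^ card D * (N * max \<rho> (1 - min \<eta> (real (card D) * (\<alpha> * c\<^sub>1)))) ^ (n - card D)) / N ^ n \<le>
     (\<Sum>D\<in>?DD. ?a D + ?b D)"
    unfolding sum_divide_distrib
  proof (rule sum_mono)
    fix D assume D: "D \<in> ?DD"
    define m where "m = card D"
    have mn: "m \<le> n" using D card_mono[of "{1..n}" D] by (auto simp: m_def)
    have m\<epsilon>: "real m \<le> \<epsilon> * real n" using D by (simp add: m_def)
    have "N\<^sup>2 ^ m * N ^ (n - m) = N ^ n * N ^ m"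
      using mn by (simp add: power_mult[symmetric] power_add[symmetric] add.commute)
    then have "N\<^sup>2 ^ m * (N * X) ^ (n - m) / N ^ n = N ^ m * X ^ (n - m)" for X
      using N by (simp add: power_mult_distrib field_simps)
    then have "N\<^sup>2 ^ m * (N * max \<rho> (1 - min \<eta> (real m * (\<alpha> * c\<^sub>1)))) ^ (n - m) / N ^ n =
        N ^ m * max \<rho> (1 - min \<eta> (real m * (\<alpha> * c\<^sub>1))) ^ (n - m)" .
    also have "\<dots> \<le> N ^ m * (max \<rho> (1 - \<eta>) ^ (n - m) + exp (- (real m * (\<alpha> * c\<^sub>1) * real (n - m))))"
      using N by (intro mult_left_mono max_power_le \<rho> \<eta>) auto
    also have "exp (- (real m * (\<alpha> * c\<^sub>1) * real (n - m))) \<le> (real n powr (- (c * c\<^sub>1 * (1 - \<epsilon>)))) ^ m"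
    proof -
      have "(1 - \<epsilon>) * real n \<le> real (n - m)" using mn m\<epsilon> by (simp add: of_nat_diff algebra_simps)
      moreover have "0 \<le> real m * (\<alpha> * c\<^sub>1)" using c n by (simp add: \<alpha>)
      ultimately have "real m * (\<alpha> * c\<^sub>1) * ((1 - \<epsilon>) * real n) \<le> real m * (\<alpha> * c\<^sub>1) * real (n - m)"
        by (intro mult_left_mono)
      moreover have "real m * (\<alpha> * c\<^sub>1) * ((1 - \<epsilon>) * real n) = real m * (c * c\<^sub>1 * (1 - \<epsilon>) * ln (real n))"
        using n by (simp add: \<alpha>)
      moreover have "(real n powr (- (c * c\<^sub>1 * (1 - \<epsilon>)))) ^ m = exp (- (real m * (c * c\<^sub>1 * (1 - \<epsilon>) * ln (real n))))"
        using n by (simp add: powr_def exp_of_nat_mult[symmetric])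
      ultimately show ?thesis by simp
    qed
    finally show "N\<^sup>2 ^ card D * (N * max \<rho> (1 - min \<eta> (real (card D) * (\<alpha> * c\<^sub>1)))) ^ (n - card D) / N ^ n \<le> ?a D + ?b D"
      using N unfolding m_def[symmetric] by (simp add: power_mult_distrib distrib_left)
  qed
  also have "\<dots> = (\<Sum>D\<in>?DD. ?a D) + (\<Sum>D\<in>?DD. ?b D)" by (rule sum.distrib)
  also have "\<dots> \<le> (\<Sum>D | D \<subseteq> {1..n} \<and> real (card D) \<le> \<epsilon> * real n. ?a D) + (\<Sum>D | D \<subseteq> {1..n} \<and> D \<noteq> {}. ?b D)"
    using N \<rho> by (intro add_mono sum_mono2 fin) (auto simp: le_max_iff_disj)
  finally show ?thesis .
qed

text \<open>For large \<open>c\<close> the value \<open>c * ln (real n) / real n\<close> exceeds 1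
  at some small \<open>n\<close>, where no element can be balanced; balancedness is therefore
  assumed only eventually.\<close>

theorem theorem2p2:
  fixes p d :: nat and c :: real
    and \<Omega> :: "nat \<Rightarrow> (nat \<times> nat) set"
    and U :: "'g::{finite,ab_group_add} \<times> 'g \<Rightarrow> 'r::nontriv mod_ring"
    and B :: "'g \<times> 'g \<Rightarrow> 'g \<times> 'g \<Rightarrow> 'r mod_ring"
    and M :: "nat \<Rightarrow> 'w measure"
    and x :: "nat \<Rightarrow> nat \<Rightarrow> nat \<Rightarrow> 'w \<Rightarrow> 'r mod_ring"
  assumes "prime p" and "d \<ge> 1" and "CARD('r) = p ^ d"
    and "\<exists>m. CARD('g) = p ^ m"
    and "\<forall>g::'g. (\<Sum>i<p ^ d. g) = 0"
    and "c > 1"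
    and "\<Omega> = Omega1 \<or> \<Omega> = Omega2"
    and "condition_i B" and "condition_ii B" and "condition_iii \<Omega> B"
    and "\<And>n. prob_space (M n)"
    and "\<And>n k l. (k, l) \<in> \<Omega> n \<union> Diag n \<Longrightarrow> x k l n \<in> measurable (M n) (count_space UNIV)"
    and "\<forall>\<^sub>F n in sequentially. \<forall>(k, l) \<in> \<Omega> n \<union> Diag n.
           balanced p (c * ln (real n) / real n) (M n) (x k l n)"
  shows "(\<lambda>n. 1 / real CARD('g) ^ n *
            cmod (\<Sum>g\<in>({1..n} \<rightarrow>\<^sub>E UNIV) - G_tr U B n.
              (\<Prod>k\<in>{1..n}. (\<integral>\<omega>. zeta_pow (U (g k) * x k k n \<omega>) \<partial>M n)) *
              (\<Prod>(k, l)\<in>\<Omega> n. (\<integral>\<omega>. zeta_pow (B (g k) (g l) * x k l n \<omega>) \<partial>M n))))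
         \<longlonglongrightarrow> 0"
proof -
  define N where "N = real CARD('g)"
  define C where "C = real CARD(('g \<times> 'g) set)"
  define \<alpha> where "\<alpha> n = c * ln (real n) / real n" for n
  have N: "1 \<le> N" by (simp add: N_def Suc_le_eq)
  obtain \<kappa> where \<kappa>: "0 < \<kappa>" "\<kappa> \<le> 1" "\<And>t::'r mod_ring. t \<noteq> 0 \<Longrightarrow> Re (zeta_pow t) \<le> 1 - \<kappa>"
    using zeta_pow_gap[where 'r = 'r] by blast
  obtain \<rho> where \<rho>: "0 \<le> \<rho>" "\<rho> < 1" "\<And>H (F :: 'g \<times> 'g \<Rightarrow> 'r mod_ring). \<not> F constant_on H \<Longrightarrow>
      cmod (\<Sum>h\<in>H. zeta_pow (F h)) \<le> \<rho> * real (card H)"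
    using uniform_nonconst_bound[where 'v = "'g \<times> 'g" and 'r = 'r] by blast
  \<comment> \<open>This choice makes \<open>c (1 - 2 \<eta>) = (c + 1) / 2 > 1\<close>.\<close>
  define \<eta> where "\<eta> = (c - 1) / (4 * c)"
  have \<eta>: "0 < \<eta>" "\<eta> \<le> 1/2" "c * (1 - 2 * \<eta>) = (c + 1) / 2"
    using \<open>c > 1\<close> by (auto simp: \<eta>_def field_simps)
  have \<rho>': "0 \<le> max \<rho> (1 - \<eta>)" "max \<rho> (1 - \<eta>) < 1"
    using \<rho>(1,2) \<eta>(1) by (auto simp: le_max_iff_disj)
  obtain \<delta>1 where \<delta>1: "\<delta>1 > 0" "\<And>\<delta>. \<delta> \<le> \<delta>1 \<Longrightarrow>
     (\<lambda>n. \<Sum>D | D \<subseteq> {1..n::nat} \<and> real (card D) \<le> \<delta> * real n. N ^ card D * max \<rho> (1 - \<eta>) ^ (n - card D)) \<longlonglongrightarrow> 0"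
    using sum_small_subsets_tendsto_0[OF \<rho>' N] by blast
  \<comment> \<open>Degenerate tuples are counted with base \<open>N - 1\<close>; division by
    \<open>N ^ n\<close> makes this \<open>1 - 1 / N\<close>.\<close>
  obtain \<delta>2 where \<delta>2: "\<delta>2 > 0" "\<And>\<delta>. \<delta> \<le> \<delta>2 \<Longrightarrow>
     (\<lambda>n. \<Sum>D | D \<subseteq> {1..n::nat} \<and> real (card D) \<le> \<delta> * real n. N ^ card D * (1 - 1 / N) ^ (n - card D)) \<longlonglongrightarrow> 0"
    using sum_small_subsets_tendsto_0[of "1 - 1 / N" N] N by auto
  \<comment> \<open>The first two bounds meet the thresholds, \<open>\<delta>2\<close> being halved
    because degenerate tuples have radius \<open>2 * \<epsilon>\<close>. The third keeps
    \<open>c * (1 - 2 * \<eta>) * (1 - \<epsilon>)\<close> at least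
    \<open>(c + 3) / 4 > 1\<close>.\<close>
  define \<epsilon> where "\<epsilon> = min (min \<delta>1 (\<delta>2 / 2)) ((c - 1) / (2 * (c + 1)))"
  have \<epsilon>: "0 < \<epsilon>" "\<epsilon> \<le> \<delta>1" "2 * \<epsilon> \<le> \<delta>2" "\<epsilon> \<le> (c - 1) / (2 * (c + 1))"
    using \<delta>1 \<delta>2 \<open>c > 1\<close> by (auto simp: \<epsilon>_def)
  have \<epsilon>1: "\<epsilon> \<le> 1"
  proof -
    have "(c - 1) / (2 * (c + 1)) \<le> 1" using \<open>c > 1\<close> by (simp add: field_simps)
    then show ?thesis using \<epsilon>(4) by linarith
  qed
  have c2: "c * (1 - 2 * \<eta>) * (1 - \<epsilon>) > 1"
  proof -
    have "1 < (c + 3) / 4" using \<open>c > 1\<close> by simp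
    also have "\<dots> = (c + 1) / 2 * (1 - (c - 1) / (2 * (c + 1)))"
      using \<open>c > 1\<close> by (simp add: field_simps)
    also have "\<dots> \<le> (c + 1) / 2 * (1 - \<epsilon>)"
      using \<epsilon>(4) \<open>c > 1\<close> by (intro mult_left_mono) auto
    finally show ?thesis unfolding \<eta>(3) .
  qed
  define e where "e = \<epsilon> / N\<^sup>2"
  have e: "e > 0" using \<epsilon> N by (simp add: e_def)
  \<comment> \<open>After division by \<open>N ^ n\<close>, \<open>S1\<close> and \<open>S3\<close>
    bound the tuples near some \<open>W\<close> with exceptional entries, \<open>S2\<close> the
    degenerate ones, \<open>S4\<close> the spread ones and \<open>S5\<close> those lying entirely in
    \<open>W\<close>.\<close>
  define S1 where "S1 n = (\<Sum>D | D \<subseteq> {1..n::nat} \<and> real (card D) \<le> \<epsilon> * real n. N ^ card D * max \<rho> (1 - \<eta>) ^ (n - card D))" for n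
  define S2 where "S2 n = (\<Sum>D | D \<subseteq> {1..n::nat} \<and> real (card D) \<le> 2 * \<epsilon> * real n. N ^ card D * (1 - 1 / N) ^ (n - card D))" for n
  define S3 where "S3 n = (\<Sum>D | D \<subseteq> {1..n::nat} \<and> D \<noteq> {}. (N * real n powr (- (c * (1 - 2 * \<eta>) * (1 - \<epsilon>)))) ^ card D)" for n
  define S4 where "S4 n = N ^ n * exp (- (\<kappa> * c * e / 4 * (e * real n - 1) * ln (real n)))" for n
  define S5 where "S5 n = (1 - \<kappa> * (c * ln (real n) / real n) / 2 / N) ^ n" for n
  have S1: "S1 \<longlonglongrightarrow> 0" unfolding S1_def by (rule \<delta>1(2)[OF \<epsilon>(2)])
  have S2: "S2 \<longlonglongrightarrow> 0" unfolding S2_def by (rule \<delta>2(2)[OF \<epsilon>(3)])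
  have S3: "S3 \<longlonglongrightarrow> 0"
    unfolding S3_def using N by (intro sum_nonempty_subsets_powr_tendsto_0 c2) auto
  have S4: "S4 \<longlonglongrightarrow> 0"
    unfolding S4_def using N \<kappa> e \<open>c > 1\<close> by (intro exponential_beats_tendsto_0) auto
  have S5: "S5 \<longlonglongrightarrow> 0"
    unfolding S5_def using N \<kappa> \<open>c > 1\<close> by (intro ln_over_n_power_tendsto_0) auto
  let ?bound = "\<lambda>n. S4 n + C * S2 n + C * ((S1 n + S3 n) + 2 * (C * S2 n) + S5 n)"
  let ?f = "\<lambda>n. 1 / real CARD('g) ^ n *
            cmod (\<Sum>g\<in>({1..n} \<rightarrow>\<^sub>E UNIV) - G_tr U B n.
              (\<Prod>k\<in>{1..n}. (\<integral>\<omega>. zeta_pow (U (g k) * x k k n \<omega>) \<partial>M n)) *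
              (\<Prod>(k, l)\<in>\<Omega> n. (\<integral>\<omega>. zeta_pow (B (g k) (g l) * x k l n \<omega>) \<partial>M n)))"
  have "?bound \<longlonglongrightarrow> 0 + C * 0 + C * ((0 + 0) + 2 * (C * 0) + 0)"
    by (intro tendsto_intros S1 S2 S3 S4 S5)
  then have lim: "?bound \<longlonglongrightarrow> 0" by simp
  have "\<forall>\<^sub>F n in sequentially. \<alpha> n \<le> 1/2"
  proof -
    have "\<alpha> \<longlonglongrightarrow> 0" unfolding \<alpha>_def by real_asymp
    then have "\<forall>\<^sub>F n in sequentially. \<alpha> n < 1/2" by (rule order_tendstoD) simp
    then show ?thesis by eventually_elim simp
  qed
  moreover have "\<forall>\<^sub>F n in sequentially. 1 \<le> e * real n"
    using e by real_asymp
  ultimately have up: "\<forall>\<^sub>F n in sequentially. ?f n \<le> ?bound n"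
    using assms(13) eventually_ge_at_top[of 1]
  proof eventually_elim
    case (elim n)
    define w where "w k l r = measure (M n) {\<omega>\<in>space (M n). x k l n \<omega> = r}" for k l r
    interpret prob_space "M n" by (rule assms(11))
    have meas: "x k l n \<in> measurable (M n) (count_space UNIV)" if "(k, l) \<in> \<Omega> n \<or> k = l \<and> k \<in> {1..n}" for k l
      by (rule assms(12)) (use that in \<open>auto simp: Diag_def\<close>)
    have bal: "balanced_weights p (\<alpha> n) (w k l)" if kl: "(k, l) \<in> \<Omega> n \<or> k = l \<and> k \<in> {1..n}" for k l
    proof -
      have "(k, l) \<in> \<Omega> n \<union> Diag n" using kl by (auto simp: Diag_def)
      with elim(3) have "balanced p (\<alpha> n) (M n) (x k l n)" unfolding \<alpha>_def by blast
      from balanced_imp_balanced_weights[OF meas[OF kl] this] show ?thesis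
        unfolding w_def .
    qed
    have ex: "(\<integral>\<omega>. zeta_pow (t * x k l n \<omega>) \<partial>M n) = char_fun (w k l) t"
      if "(k, l) \<in> \<Omega> n \<or> k = l \<and> k \<in> {1..n}" for k l t
      using expectation_zeta_pow[OF meas[OF that]] unfolding w_def .
    interpret balanced_system p d n "\<alpha> n" "\<Omega> n" w U B
    proof unfold_locales
      show "0 \<le> \<alpha> n" using \<open>c > 1\<close> elim(4) by (simp add: \<alpha>_def)
      show "\<Omega> n \<subseteq> {1..n} \<times> {1..n}" using assms(7) by (auto simp: Omega1_def Omega2_def)
      show "(k, l) \<in> \<Omega> n \<and> (l, k) \<in> \<Omega> n \<or> (symmetric_map B \<or> alternating_map B) \<and> ((k, l) \<in> \<Omega> n \<or> (l, k) \<in> \<Omega> n)"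
        if "k \<in> {1..n}" "l \<in> {1..n}" "k \<noteq> l" for k l
        using assms(7)
      proof
        assume "\<Omega> = Omega1"
        then show ?thesis using that by (simp add: Omega1_def)
      next
        assume *: "\<Omega> = Omega2"
        then have "symmetric_map B \<or> alternating_map B" using assms(10) by (simp add: condition_iii_def)
        moreover have "(k, l) \<in> \<Omega> n \<or> (l, k) \<in> \<Omega> n" using that * by (auto simp: Omega2_def)
        ultimately show ?thesis by blast
      qed
    qed (use assms elim bal in auto)
    have "(\<Prod>k\<in>{1..n}. (\<integral>\<omega>. zeta_pow (U (g k) * x k k n \<omega>) \<partial>M n)) *
              (\<Prod>(k, l)\<in>\<Omega> n. (\<integral>\<omega>. zeta_pow (B (g k) (g l) * x k l n \<omega>) \<partial>M n)) = summand g" for g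
      unfolding summand_eq by (intro arg_cong2[where f = times] prod.cong refl) (auto simp: ex)
    then have "?f n = cmod (\<Sum>g\<in>tuples - G_tr U B n. summand g) / N ^ n"
      by (simp add: tuples_def N_def)
    also have "\<dots> \<le> (N\<^sup>2 ^ n * exp (- (\<kappa> * \<alpha> n / 4 * (e * real n * (e * real n - 1)))) +
       real (card (degenerate (2 * \<epsilon>))) +
       C * ((\<Sum>D | D \<subseteq> {1..n} \<and> D \<noteq> {} \<and> real (card D) \<le> \<epsilon> * real n.
          N\<^sup>2 ^ card D * (N * max \<rho> (1 - min \<eta> (real (card D) * (\<alpha> n * (1 - 2 * \<eta>))))) ^ (n - card D)) +
        2 * real (card (degenerate (2 * \<epsilon>))) + (N - \<kappa> * \<alpha> n / 2) ^ n)) / N ^ n"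
    proof (rule divide_right_mono)
      have "1 \<le> \<epsilon> / (real CARD('g))\<^sup>2 * real n" using elim(2) by (simp add: e_def N_def)
      from norm_sum_nontrivial_le[OF less_imp_le[OF \<epsilon>(1)] this less_imp_le[OF \<eta>(1)] \<eta>(2) \<rho>(1,3) \<kappa>]
      show "cmod (\<Sum>g\<in>tuples - G_tr U B n. summand g) \<le> N\<^sup>2 ^ n * exp (- (\<kappa> * \<alpha> n / 4 * (e * real n * (e * real n - 1)))) +
       real (card (degenerate (2 * \<epsilon>))) +
       C * ((\<Sum>D | D \<subseteq> {1..n} \<and> D \<noteq> {} \<and> real (card D) \<le> \<epsilon> * real n.
          N\<^sup>2 ^ card D * (N * max \<rho> (1 - min \<eta> (real (card D) * (\<alpha> n * (1 - 2 * \<eta>))))) ^ (n - card D)) +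
        2 * real (card (degenerate (2 * \<epsilon>))) + (N - \<kappa> * \<alpha> n / 2) ^ n)"
        unfolding e_def N_def C_def .
    qed (use N in simp)
    also have "\<dots> = N\<^sup>2 ^ n * exp (- (\<kappa> * \<alpha> n / 4 * (e * real n * (e * real n - 1)))) / N ^ n +
       real (card (degenerate (2 * \<epsilon>))) / N ^ n +
       C * ((\<Sum>D | D \<subseteq> {1..n} \<and> D \<noteq> {} \<and> real (card D) \<le> \<epsilon> * real n.
          N\<^sup>2 ^ card D * (N * max \<rho> (1 - min \<eta> (real (card D) * (\<alpha> n * (1 - 2 * \<eta>))))) ^ (n - card D)) / N ^ n +
        2 * (real (card (degenerate (2 * \<epsilon>))) / N ^ n) + (N - \<kappa> * \<alpha> n / 2) ^ n / N ^ n)"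
      by (simp add: add_divide_distrib distrib_left)
    also have "\<dots> \<le> ?bound n"
    proof -
      have 4: "N\<^sup>2 ^ n * exp (- (\<kappa> * \<alpha> n / 4 * (e * real n * (e * real n - 1)))) / N ^ n = S4 n"
      proof -
        have "N\<^sup>2 ^ n / N ^ n = N ^ n" using N by (simp add: power2_eq_square power_mult_distrib)
        \<comment> \<open>Since \<open>\<alpha> n * real n = c * ln (real n)\<close>, the quadratic
          number of small factors yields an exponent of order n log n.\<close>
        moreover have "\<kappa> * \<alpha> n / 4 * (e * real n * (e * real n - 1)) = \<kappa> * c * e / 4 * (e * real n - 1) * ln (real n)"
          using elim(4) by (simp add: \<alpha>_def)
        ultimately show ?thesis unfolding S4_def by (metis times_divide_eq_left)
      qed
      have 2: "real (card (degenerate (2 * \<epsilon>))) / N ^ n \<le> C * S2 n"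
      proof -
        have "real (card (degenerate (2 * \<epsilon>))) / N ^ n \<le> C * (\<Sum>D | D \<subseteq> {1..n} \<and> real (card D) \<le> 2 * \<epsilon> * real n.
            N\<^sup>2 ^ card D * (N - 1) ^ (n - card D)) / N ^ n"
          using card_degenerate_le[of "2 * \<epsilon>"] N unfolding C_def N_def by (intro divide_right_mono) auto
        also have "\<dots> = C * (\<Sum>D | D \<subseteq> {1..n} \<and> real (card D) \<le> 2 * \<epsilon> * real n.
            N\<^sup>2 ^ card D * (N - 1) ^ (n - card D) / N ^ n)"
          by (simp only: sum_divide_distrib[symmetric] times_divide_eq_right)
        also have "\<dots> = C * S2 n"
          unfolding S2_def
        proof (intro arg_cong2[where f = times] refl sum.cong)
          fix D assume "D \<in> {D. D \<subseteq> {1..n} \<and> real (card D) \<le> 2 * \<epsilon> * real n}"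
          then have "card D \<le> n" using card_mono[of "{1..n}" D] by auto
          then have "N ^ n = N ^ card D * N ^ (n - card D)" by (simp flip: power_add)
          moreover have "1 - 1 / N = (N - 1) / N" using N by (simp add: field_simps)
          ultimately show "N\<^sup>2 ^ card D * (N - 1) ^ (n - card D) / N ^ n = N ^ card D * (1 - 1 / N) ^ (n - card D)"
            using N by (simp add: power2_eq_square power_mult_distrib power_divide)
        qed
        finally show ?thesis .
      qed
      have 5: "(N - \<kappa> * \<alpha> n / 2) ^ n / N ^ n = S5 n"
        using N unfolding S5_def \<alpha>_def power_divide[symmetric] by (simp add: diff_divide_distrib)
      have "0 \<le> 1 - 2 * \<eta>" using \<eta>(2) by simp
      then have 13: "(\<Sum>D | D \<subseteq> {1..n} \<and> D \<noteq> {} \<and> real (card D) \<le> \<epsilon> * real n.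
          N\<^sup>2 ^ card D * (N * max \<rho> (1 - min \<eta> (real (card D) * (\<alpha> n * (1 - 2 * \<eta>))))) ^ (n - card D)) / N ^ n \<le> S1 n + S3 n"
        unfolding S1_def S3_def using N \<rho> \<eta> \<epsilon> \<epsilon>1 \<open>c > 1\<close> elim(4) by (intro sum_subsets_le) (auto simp: \<alpha>_def)
      have C0: "0 \<le> C" by (simp add: C_def)
      show ?thesis unfolding 4 5 using 2 13 by (intro add_mono mult_left_mono C0 order_refl) auto
    qed
    finally show ?case .
  qed
  show ?thesis
    by (rule tendsto_sandwich[OF always_eventually up tendsto_const lim]) simp
qed

end
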